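(* Let $A \in \mathbb{F}^{n\times n}$, $Y = \mathrm{diag}(y_1, \ldots, y_n)$ and $h(y_1, \ldots, y_n) = \det(A+Y)$, with black-box access to $h$. Suppose we are given matrices $B_0, \ldots, B_n \in \mathbb{F}^{r\times r}$, with $B_1, \ldots, B_n$ of rank $1$, such that $\det(A+Y) = \det(B_0 + \sum_{i\in[n]} B_iy_i)$. Then one can in deterministic polynomial time compute a matrix $A' \in \mathbb{F}^{n\times n}$ such that $h(y_1, \ldots, y_n) = \det(A' + Y)$.
   Context: Black-box access to a polynomial means one may query its value at any chosen point at unit cost per query. *)

theory Defs
  imports
    "Jordan_Normal_Form.Determinant"
    "Jordan_Normal_Form.DL_Rank"
    "HOL-Computational_Algebra.Polynomial"
    "HOL-Library.Poly_Mapping"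
begin

subsection \<open>Polynomials in several variables\<close>

text \<open>A monomial is a finitely supported exponent vector, a polynomial a finitely supported
  family of coefficients. Equality is equality of formal polynomials, which over a finite field is
  in general finer than equality of the induced functions.\<close>

type_synonym 'a mpoly = "(nat \<Rightarrow>\<^sub>0 nat) \<Rightarrow>\<^sub>0 'a"

definition mconst :: "'a::zero \<Rightarrow> 'a mpoly" where
  "mconst c = Poly_Mapping.single 0 c"

definition mvar :: "nat \<Rightarrow> 'a::zero_neq_one mpoly" where
  "mvar i = Poly_Mapping.single (Poly_Mapping.single i 1) 1"

definition meval :: "'a::comm_semiring_1 mpoly \<Rightarrow> (nat \<Rightarrow> 'a) \<Rightarrow> 'a" where
  "meval p x = (\<Sum>m\<in>Poly_Mapping.keys p. Poly_Mapping.lookup p m *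
     (\<Prod>i\<in>Poly_Mapping.keys m. x i ^ Poly_Mapping.lookup m i))"

text \<open>Matrix rows and columns are indexed from 0 but the variables are \<open>y\<^sub>1, \<dots>, y\<^sub>n\<close>,
  whence the shift.\<close>

definition Ydiag :: "nat \<Rightarrow> 'a::zero_neq_one mpoly mat" where
  "Ydiag n = mat_diag n (\<lambda>j. mvar (Suc j))"

definition det_plus_Y :: "nat \<Rightarrow> 'a::comm_ring_1 mat \<Rightarrow> 'a mpoly" where
  "det_plus_Y n A = det (map_mat mconst A + Ydiag n)"

definition pencil :: "nat \<Rightarrow> nat \<Rightarrow> (nat \<Rightarrow> 'a::comm_ring_1 mat) \<Rightarrow> 'a mpoly mat" where
  "pencil n r B = mat r r (\<lambda>(a, b).
     mconst (B 0 $$ (a, b)) + (\<Sum>i\<in>{1..n}. mconst (B i $$ (a, b)) * mvar i))"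


subsection \<open>Deterministic algorithms over a field with an oracle\<close>

text \<open>The model is the uniform arithmetic one. A program is a finite text, fixed for inputs of all
  sizes, in a language with natural number variables (for sizes, indices and counters) and
  arrays of field elements. Field elements are only accessible through the field operations,
  equality tests and oracle queries; the only constants are 0 and 1, so that the type of programs
  does not depend on the field. There is no conversion between the two sorts.\<close>

datatype nexp =
    NConst nat
  | NVar string
  | NPlus nexp nexp
  | NMinus nexp nexp

datatype fexp =
    FZero
  | FOne
  | FGet string "nexp list"
  | FPlus fexp fexp
  | FMinus fexp fexp
  | FTimes fexp fexp
  | FDivide fexp fexp

datatype bexp =
    BLess nexp nexp
  | BEq fexp fexp
  | BNot bexp
  | BAnd bexp bexp

datatype com =
    Skip
  | NSet string nexp
  | FSet string "nexp list" fexp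
  | Query string "nexp list" string
  | Seq com com
  | Cond bexp com com
  | While bexp com

record 'a state =
  nvars :: "string \<Rightarrow> nat"
  arrs :: "string \<Rightarrow> nat list \<Rightarrow> 'a"

primrec neval :: "nexp \<Rightarrow> 'a state \<Rightarrow> nat" where
  "neval (NConst k) s = k"
| "neval (NVar x) s = nvars s x"
| "neval (NPlus a b) s = neval a s + neval b s"
| "neval (NMinus a b) s = neval a s - neval b s"

definition neval_list :: "nexp list \<Rightarrow> 'a state \<Rightarrow> nat list" where
  "neval_list is s = map (\<lambda>e. neval e s) is"

text \<open>Division by zero yields 0, as in the library; a program can test for this case.\<close>

primrec feval :: "fexp \<Rightarrow> 'a::field state \<Rightarrow> 'a" where
  "feval FZero s = 0"
| "feval FOne s = 1"
| "feval (FGet X is) s = arrs s X (neval_list is s)"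
| "feval (FPlus a b) s = feval a s + feval b s"
| "feval (FMinus a b) s = feval a s - feval b s"
| "feval (FTimes a b) s = feval a s * feval b s"
| "feval (FDivide a b) s = feval a s / feval b s"

primrec beval :: "bexp \<Rightarrow> 'a::field state \<Rightarrow> bool" where
  "beval (BLess a b) s = (neval a s < neval b s)"
| "beval (BEq a b) s = (feval a s = feval b s)"
| "beval (BNot b) s = (\<not> beval b s)"
| "beval (BAnd a b) s = (beval a s \<and> beval b s)"

text \<open>Field operations, equality tests and oracle queries have unit cost. Natural numbers are
  charged by magnitude, i.e. in unary, so that large numbers cannot be used to pack
  superpolynomially much work into one step.\<close>

primrec ncost :: "nexp \<Rightarrow> 'a state \<Rightarrow> nat" where
  "ncost (NConst k) s = 1 + k"
| "ncost (NVar x) s = 1 + nvars s x"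
| "ncost (NPlus a b) s = 1 + ncost a s + ncost b s"
| "ncost (NMinus a b) s = 1 + ncost a s + ncost b s"

definition ncost_list :: "nexp list \<Rightarrow> 'a state \<Rightarrow> nat" where
  "ncost_list is s = (\<Sum>e\<leftarrow>is. ncost e s)"

primrec fcost :: "fexp \<Rightarrow> 'a::field state \<Rightarrow> nat" where
  "fcost FZero s = 1"
| "fcost FOne s = 1"
| "fcost (FGet X is) s = 1 + ncost_list is s"
| "fcost (FPlus a b) s = 1 + fcost a s + fcost b s"
| "fcost (FMinus a b) s = 1 + fcost a s + fcost b s"
| "fcost (FTimes a b) s = 1 + fcost a s + fcost b s"
| "fcost (FDivide a b) s = 1 + fcost a s + fcost b s"

primrec bcost :: "bexp \<Rightarrow> 'a::field state \<Rightarrow> nat" where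
  "bcost (BLess a b) s = 1 + ncost a s + ncost b s"
| "bcost (BEq a b) s = 1 + fcost a s + fcost b s"
| "bcost (BNot b) s = 1 + bcost b s"
| "bcost (BAnd a b) s = 1 + bcost a s + bcost b s"

lemma neval_less_ncost: "neval e s < ncost e s"
  by (induction e) auto

definition store :: "string \<Rightarrow> nat list \<Rightarrow> 'a \<Rightarrow> 'a state \<Rightarrow> 'a state" where
  "store X is v s = s\<lparr>arrs := (arrs s)(X := (arrs s X)(is := v))\<rparr>"

text \<open>\<open>exec h c s t s'\<close>: started in \<open>s\<close>, the program \<open>c\<close> halts in \<open>s'\<close> after total cost \<open>t\<close>.
  The black box \<open>h\<close> is queried at the point whose \<open>i\<close>-th coordinate is the entry \<open>[i]\<close> of the given
  array; for a polynomial in \<open>y\<^sub>1, \<dots>, y\<^sub>n\<close> only the entries \<open>[1], \<dots>, [n]\<close> matter.\<close>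

inductive exec :: "((nat \<Rightarrow> 'a::field) \<Rightarrow> 'a) \<Rightarrow> com \<Rightarrow> 'a state \<Rightarrow> nat \<Rightarrow> 'a state \<Rightarrow> bool"
  for h where
  Skip: "exec h Skip s 1 s"
| NSet: "exec h (NSet x e) s (1 + ncost e s) (s\<lparr>nvars := (nvars s)(x := neval e s)\<rparr>)"
| FSet: "exec h (FSet X is e) s (1 + ncost_list is s + fcost e s)
           (store X (neval_list is s) (feval e s) s)"
| Query: "exec h (Query X is Z) s (1 + ncost_list is s)
           (store X (neval_list is s) (h (\<lambda>i. arrs s Z [i])) s)"
| Seq: "exec h c1 s t1 s1 \<Longrightarrow> exec h c2 s1 t2 s2 \<Longrightarrow> exec h (Seq c1 c2) s (t1 + t2) s2"
| CondTrue: "beval b s \<Longrightarrow> exec h c1 s t s' \<Longrightarrow> exec h (Cond b c1 c2) s (1 + bcost b s + t) s'"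
| CondFalse: "\<not> beval b s \<Longrightarrow> exec h c2 s t s' \<Longrightarrow> exec h (Cond b c1 c2) s (1 + bcost b s + t) s'"
| WhileFalse: "\<not> beval b s \<Longrightarrow> exec h (While b c) s (1 + bcost b s) s"
| WhileTrue: "beval b s \<Longrightarrow> exec h c s t1 s1 \<Longrightarrow> exec h (While b c) s1 t2 s2 \<Longrightarrow>
    exec h (While b c) s (1 + bcost b s + t1 + t2) s2"

lemma exec_deterministic:
  "exec h c s t s' \<Longrightarrow> exec h c s u s'' \<Longrightarrow> u = t \<and> s'' = s'"
proof (induction arbitrary: u s'' rule: exec.induct)
  case (Seq c1 s t1 s1 c2 t2 s2)
  from Seq.prems show ?case by (cases rule: exec.cases) (use Seq.IH in blast)+
next
  case (CondTrue b s c1 t s' c2)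
  from CondTrue.prems show ?case by (cases rule: exec.cases) (use CondTrue in blast)+
next
  case (CondFalse b s c2 t s' c1)
  from CondFalse.prems show ?case by (cases rule: exec.cases) (use CondFalse in blast)+
next
  case (WhileFalse b s c)
  from WhileFalse.prems show ?case by (cases rule: exec.cases) (use WhileFalse in blast)+
next
  case (WhileTrue b s c t1 s1 t2 s2)
  from WhileTrue.prems show ?case by (cases rule: exec.cases) (use WhileTrue in blast)+
qed (auto elim: exec.cases)

text \<open>Input: the sizes \<open>n\<close>, \<open>r\<close> and the entries of \<open>B\<^sub>0, \<dots>, B\<^sub>n\<close>; all other storage is 0.\<close>

definition input_state :: "nat \<Rightarrow> nat \<Rightarrow> (nat \<Rightarrow> 'a::field mat) \<Rightarrow> 'a state" where
  "input_state n r B = \<lparr>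
     nvars = (\<lambda>_. 0)(''n'' := n, ''r'' := r),
     arrs = (\<lambda>X is. case is of
         [k, i, j] \<Rightarrow> if X = ''B'' \<and> k \<le> n \<and> i < r \<and> j < r then B k $$ (i, j) else 0
       | _ \<Rightarrow> 0)\<rparr>"

definition output_mat :: "nat \<Rightarrow> 'a state \<Rightarrow> 'a mat" where
  "output_mat n s = mat n n (\<lambda>(i, j). arrs s ''A'' [i, j])"

end

theory Submission
  imports Defs
begin

text \<open>
  Write \<open>B\<^sub>i = u\<^sub>i v\<^sub>i\<^sup>T\<close>, let \<open>U\<close> have the columns \<open>u\<^sub>i\<close> and \<open>V\<close> the rows \<open>v\<^sub>i\<^sup>T\<close>, so that the pencil is
  \<open>B\<^sub>0 + U Y V\<close>, and let \<open>K = [[0, V], [U, B\<^sub>0]]\<close>. Comparing the coefficients of \<open>y\<^sub>1 \<cdots> y\<^sub>n\<close> gives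
  \<open>det K = (-1)\<^sup>n\<close>. The matrix \<open>M = [[-I, Y V], [U, B\<^sub>0]] = diag(Y, I) K - diag(I, 0)\<close> has determinant
  \<open>(-1)\<^sup>n det (B\<^sub>0 + U Y V)\<close>, while \<open>M K\<^sup>-\<^sup>1\<close> is block triangular with diagonal blocks \<open>Y - L\<close> and \<open>I\<close>,
  where \<open>L\<close> is the upper left \<open>n \<times> n\<close> block of \<open>K\<^sup>-\<^sup>1\<close>. Hence \<open>A' = -L\<close> is as wanted, and it is computed
  by Gauss--Jordan elimination without any oracle query.
\<close>

subsection \<open>Determinants of bordered matrices\<close>

text \<open>Schur complement: \<open>?T\<close> is block unitriangular, and multiplying by it on the
  right clears the upper right block and leaves \<open>B0 + U * Y * V\<close> below. The sign is the
  determinant of \<open>- 1\<^sub>m n\<close>.\<close>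

lemma det_bordered:
  fixes U V B0 :: "'a::idom mat"
  assumes U: "U \<in> carrier_mat r n" and V: "V \<in> carrier_mat n r" and B0: "B0 \<in> carrier_mat r r"
    and Y: "Y \<in> carrier_mat n n"
  shows "det (four_block_mat (- 1\<^sub>m n) (Y * V) U B0) = (-1) ^ n * det (B0 + U * Y * V)"
proof -
  let ?M = "four_block_mat (- 1\<^sub>m n) (Y * V) U B0"
  let ?T = "four_block_mat (1\<^sub>m n) (Y * V) (0\<^sub>m r n) (1\<^sub>m r)"
  have YV: "Y * V \<in> carrier_mat n r" using Y V by simp
  have c: "U * (Y * V) = U * Y * V" by (rule assoc_mult_mat[symmetric, OF U Y V])
  have "- 1\<^sub>m n * (Y * V) + Y * V * 1\<^sub>m r = 0\<^sub>m n r"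
    using YV Y V by simp
  moreover have "U * (Y * V) + B0 * 1\<^sub>m r = B0 + U * Y * V"
    unfolding c using U Y V B0 by (subst comm_add_mat[of _ r r]) auto
  moreover have "- 1\<^sub>m n * 1\<^sub>m n + Y * V * 0\<^sub>m r n = - 1\<^sub>m n"
    using Y V by simp
  moreover have "U * 1\<^sub>m n + B0 * 0\<^sub>m r n = U" using U B0 by simp
  ultimately have "?M * ?T = four_block_mat (- 1\<^sub>m n) (0\<^sub>m n r) U (B0 + U * Y * V)"
    using U YV B0 by (subst mult_four_block_mat[of _ n n _ r _ r _ _ n _ r]) auto
  moreover have "det (?M * ?T) = det ?M * det ?T"
    by (rule det_mult[of _ "n + r"]) (use U YV B0 in auto)
  moreover have "det ?T = 1"
    using YV by (subst det_four_block_mat_lower_left_zero[of _ n _ r]) auto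
  moreover have "det (four_block_mat (- 1\<^sub>m n) (0\<^sub>m n r) U (B0 + U * Y * V))
      = det (- 1\<^sub>m n :: 'a mat) * det (B0 + U * Y * V)"
    using U Y V B0 by (intro det_four_block_mat_upper_right_zero[of _ n _ r]) auto
  moreover have "- 1\<^sub>m n = (- 1 :: 'a) \<cdot>\<^sub>m 1\<^sub>m n" by auto
  then have "det (- 1\<^sub>m n :: 'a mat) = (-1) ^ n" by simp
  ultimately show ?thesis by simp
qed

text \<open>The block equations contained in \<open>inv\<close> show that the matrix of
  \<open>det_bordered\<close> times the inverse is block triangular with diagonal blocks
  \<open>- L11 + Y\<close> and the identity. The generality of \<open>idom\<close> allows polynomial
  entries.\<close>

lemma det_diag_minus_inverse_block:
  fixes U V B0 :: "'a::idom mat"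
  assumes U: "U \<in> carrier_mat r n" and V: "V \<in> carrier_mat n r" and B0: "B0 \<in> carrier_mat r r"
    and Y: "Y \<in> carrier_mat n n"
    and L: "L11 \<in> carrier_mat n n" "L12 \<in> carrier_mat n r" "L21 \<in> carrier_mat r n" "L22 \<in> carrier_mat r r"
    and inv: "four_block_mat (0\<^sub>m n n) V U B0 * four_block_mat L11 L12 L21 L22 = 1\<^sub>m (n + r)"
  shows "det (- L11 + Y) = (-1) ^ n * det (B0 + U * Y * V) * det (four_block_mat L11 L12 L21 L22)"
proof -
  let ?M = "four_block_mat (- 1\<^sub>m n) (Y * V) U B0"
  let ?L = "four_block_mat L11 L12 L21 L22"
  have eq: "four_block_mat (V * L21) (V * L22) (U * L11 + B0 * L21) (U * L12 + B0 * L22)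
      = four_block_mat (1\<^sub>m n) (0\<^sub>m n r) (0\<^sub>m r n) (1\<^sub>m r)"
    using inv U V B0 L by (subst (asm) mult_four_block_mat[of _ n n _ r _ r _ _ n _ r]) auto
  have ent: "four_block_mat (V * L21) (V * L22) (U * L11 + B0 * L21) (U * L12 + B0 * L22) $$ (i, j)
      = four_block_mat (1\<^sub>m n) (0\<^sub>m n r) (0\<^sub>m r n) (1\<^sub>m r) $$ (i, j)" for i j
    by (simp only: eq)
  have 1: "V * L21 = 1\<^sub>m n"
  proof (rule eq_matI)
    fix i j assume "i < dim_row (1\<^sub>m n)" "j < dim_col (1\<^sub>m n)"
    then show "(V * L21) $$ (i, j) = 1\<^sub>m n $$ (i, j)" using ent[of i j] U V B0 L by auto
  qed (use V L in auto)
  have 2: "V * L22 = 0\<^sub>m n r"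
  proof (rule eq_matI)
    fix i j assume "i < dim_row (0\<^sub>m n r)" "j < dim_col (0\<^sub>m n r)"
    then show "(V * L22) $$ (i, j) = 0\<^sub>m n r $$ (i, j)" using ent[of i "n + j"] U V B0 L by auto
  qed (use V L in auto)
  have 3: "U * L11 + B0 * L21 = 0\<^sub>m r n"
  proof (rule eq_matI)
    fix i j assume "i < dim_row (0\<^sub>m r n)" "j < dim_col (0\<^sub>m r n)"
    then show "(U * L11 + B0 * L21) $$ (i, j) = 0\<^sub>m r n $$ (i, j)"
      using ent[of "n + i" j] U V B0 L by auto
  qed (use U B0 L in auto)
  have 4: "U * L12 + B0 * L22 = 1\<^sub>m r"
  proof (rule eq_matI)
    fix i j assume "i < dim_row (1\<^sub>m r)" "j < dim_col (1\<^sub>m r)"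
    then show "(U * L12 + B0 * L22) $$ (i, j) = 1\<^sub>m r $$ (i, j)"
      using ent[of "n + i" "n + j"] U V B0 L by auto
  qed (use U B0 L in auto)
  have YV: "Y * V \<in> carrier_mat n r" using Y V by simp
  have "Y * V * L21 = Y" "Y * V * L22 = 0\<^sub>m n r"
    using Y V L by (simp_all add: assoc_mult_mat[OF Y V] 1 2)
  moreover have "- 1\<^sub>m n * L11 = - L11" "- 1\<^sub>m n * L12 = - L12"
    using L by simp_all
  ultimately have prod: "?M * ?L = four_block_mat (- L11 + Y) (- L12) (0\<^sub>m r n) (1\<^sub>m r)"
    using U YV B0 L
    by (subst mult_four_block_mat[of _ n n _ r _ r _ _ n _ r]) (auto simp: 3 4)
  have "det (- L11 + Y) = det (?M * ?L)"
    unfolding prod using Y L by (subst det_four_block_mat_lower_left_zero[of _ n _ r]) auto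
  also have "\<dots> = det ?M * det ?L"
    by (rule det_mult[of _ "n + r"]) (use U YV B0 L in auto)
  finally show ?thesis using det_bordered[OF U V B0 Y] by simp
qed

section \<open>Top coefficients of products and determinants\<close>

lemma coeff_mult_degree_le:
  fixes p q :: "'a::comm_semiring_0 poly"
  assumes "degree p \<le> d" "degree q \<le> e"
  shows "coeff (p * q) (d + e) = coeff p d * coeff q e"
proof -
  \<comment> \<open>Either \<open>i > d\<close>, or \<open>i < d\<close> and then
    \<open>d + e - i > e\<close>; the bounds \<open>d\<close> and \<open>e\<close> need not be
    attained.\<close>
  have "coeff p i * coeff q (d + e - i) = 0" if "i \<noteq> d" for i
    using that assms by (cases "i < d") (auto simp: coeff_eq_0)
  then have "coeff (p * q) (d + e) = (\<Sum>i\<in>{d}. coeff p i * coeff q (d + e - i))"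
    unfolding coeff_mult by (intro sum.mono_neutral_right) auto
  then show ?thesis by simp
qed

lemma coeff_prod_degree_le:
  fixes p :: "'b \<Rightarrow> 'a::comm_semiring_1 poly"
  assumes "finite I" "\<And>i. i \<in> I \<Longrightarrow> degree (p i) \<le> d i"
  shows "coeff (prod p I) (sum d I) = (\<Prod>i\<in>I. coeff (p i) (d i))"
  using assms
proof (induction I rule: finite_induct)
  case (insert x F)
  have "degree (prod p F) \<le> sum d F"
    by (rule order.trans[OF degree_prod_sum_le[OF insert(1)] sum_mono]) (use insert in auto)
  then show ?case using insert by (simp add: coeff_mult_degree_le)
qed simp

text \<open>The degree bound depends on the row alone, so all terms of the Leibniz expansion share
  the bound \<open>sum d {0..<n}\<close>, and the coefficient there is a product of one coefficient
  per row.\<close>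

lemma coeff_det_degree_le:
  fixes M :: "'a::comm_ring_1 poly mat"
  assumes M: "M \<in> carrier_mat n n"
    and deg: "\<And>i j. i < n \<Longrightarrow> j < n \<Longrightarrow> degree (M $$ (i, j)) \<le> d i"
  shows "coeff (det M) (sum d {0..<n}) = det (mat n n (\<lambda>(i, j). coeff (M $$ (i, j)) (d i)))"
proof -
  have "coeff (signof p * (\<Prod>i = 0..<n. M $$ (i, p i))) (sum d {0..<n})
      = signof p * (\<Prod>i = 0..<n. mat n n (\<lambda>(i, j). coeff (M $$ (i, j)) (d i)) $$ (i, p i))"
    if p: "p permutes {0..<n}" for p
  proof -
    have pi: "p i < n" if "i < n" for i using permutes_in_image[OF p, of i] that by simp
    have "coeff (\<Prod>i = 0..<n. M $$ (i, p i)) (sum d {0..<n}) = (\<Prod>i = 0..<n. coeff (M $$ (i, p i)) (d i))"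
      by (rule coeff_prod_degree_le) (use deg pi in auto)
    then show ?thesis using pi by (simp add: sign_def)
  qed
  then show ?thesis
    unfolding det_def'[OF M] det_def'[OF mat_carrier] coeff_sum by (intro sum.cong) auto
qed

subsection \<open>Specialising all variables to one\<close>

definition mdegree :: "(nat \<Rightarrow>\<^sub>0 nat) \<Rightarrow> nat" where
  "mdegree m = Sum_any (Poly_Mapping.lookup m)"

lemma mdegree_add: "mdegree (m + m') = mdegree m + mdegree m'"
  unfolding mdegree_def lookup_add by (rule Sum_any.distrib) (auto simp: finite_lookup)

lemma mdegree_zero [simp]: "mdegree 0 = 0"
  by (simp add: mdegree_def)

lemma mdegree_single [simp]: "mdegree (Poly_Mapping.single i k) = k"
proof -
  have "mdegree (Poly_Mapping.single i k) = Sum_any (\<lambda>j. k when i = j)"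
    by (simp add: mdegree_def lookup_single)
  then show ?thesis by simp
qed

text \<open>The substitution of one indeterminate for all variables: a monomial is sent to the power
  given by its total degree. It makes the univariate \<open>coeff\<close> and \<open>degree\<close>
  available for determinants.\<close>

definition diag_poly :: "'a::comm_ring_1 mpoly \<Rightarrow> 'a poly" where
  "diag_poly p = Sum_any (\<lambda>m. monom (Poly_Mapping.lookup p m) (mdegree m))"

lemma diag_poly_add: "diag_poly (p + q) = diag_poly p + diag_poly q"
proof -
  have fin: "finite {m. monom (Poly_Mapping.lookup p m) (mdegree m) \<noteq> 0}" for p :: "'a mpoly"
    by (rule finite_subset[OF _ finite_lookup[of p]]) auto
  show ?thesis
    unfolding diag_poly_def lookup_add add_monom[symmetric] by (rule Sum_any.distrib[OF fin fin])
qed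

lemma diag_poly_single: "diag_poly (Poly_Mapping.single m c) = monom c (mdegree m)"
proof -
  have "diag_poly (Poly_Mapping.single m c) = Sum_any (\<lambda>m'. monom c (mdegree m) when m = m')"
    unfolding diag_poly_def by (rule Sum_any.cong) (simp add: lookup_single when_def)
  then show ?thesis by simp
qed

lemma diag_poly_zero: "diag_poly 0 = 0"
  by (simp add: diag_poly_def)

lemma mpoly_induct [case_names zero add]:
  assumes "P 0" "\<And>p m c. P p \<Longrightarrow> P (p + Poly_Mapping.single m c)"
  shows "P (p :: 'a::comm_ring_1 mpoly)"
proof (induction p rule: update_induct)
  case (update f a b)
  have "Poly_Mapping.update a b f = f + Poly_Mapping.single a b"
    using update(1)
    by (intro poly_mapping_eqI) (auto simp: lookup_update lookup_add lookup_single in_keys_iff when_def)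
  then show ?case using assms(2) update by simp
qed (rule assms(1))

lemma diag_poly_mult: "diag_poly (p * q) = diag_poly p * diag_poly q"
proof (induction p rule: mpoly_induct)
  case (add p m c)
  have "diag_poly (Poly_Mapping.single m c * q) = monom c (mdegree m) * diag_poly q"
    by (induction q rule: mpoly_induct)
      (simp_all add: diag_poly_zero diag_poly_add diag_poly_single distrib_left mult_single
        mdegree_add mult_monom)
  then show ?case using add by (simp add: distrib_right diag_poly_add diag_poly_single)
qed (simp add: diag_poly_zero)

lemma comm_ring_hom_diag_poly: "comm_ring_hom (diag_poly :: 'a::comm_ring_1 mpoly \<Rightarrow> 'a poly)"
proof
  have "diag_poly (1 :: 'a mpoly) = diag_poly (Poly_Mapping.single 0 1)" by simp
  then show "diag_poly (1 :: 'a mpoly) = 1" unfolding diag_poly_single by (simp add: monom_eq_1)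
qed (auto simp: diag_poly_zero diag_poly_add diag_poly_mult)

lemma comm_ring_hom_mconst: "comm_ring_hom (mconst :: 'a::comm_ring_1 \<Rightarrow> 'a mpoly)"
  by standard (auto simp: mconst_def single_add mult_single)

lemma diag_poly_mconst [simp]: "diag_poly (mconst c) = [:c:]"
  by (simp add: mconst_def diag_poly_single monom_0)

lemma diag_poly_mvar [simp]: "diag_poly (mvar i) = [:0, 1:]"
  by (simp add: mvar_def diag_poly_single monom_altdef)


subsection \<open>Bordered matrices of pencils\<close>

lemma rank_1_nonzero_entry:
  fixes B :: "'a::field mat"
  assumes B: "B \<in> carrier_mat r r" and rank: "vec_space.rank r B = 1"
  shows "\<exists>a<r. \<exists>b<r. B $$ (a, b) \<noteq> 0"
proof (rule ccontr)
  assume "\<not> ?thesis"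
  then have "B = 0\<^sub>m r r" using B by (intro eq_matI) auto
  moreover have "vec_space.rank r (0\<^sub>m r r :: 'a mat) = 0" by (rule vec_space.rank_0I)
  ultimately show False using rank by simp
qed

text \<open>A nonvanishing minor on rows \<open>k\<close>, \<open>a\<close> and columns
  \<open>l\<close>, \<open>b\<close> would make columns \<open>l\<close> and \<open>b\<close>
  independent, so the rank would be at least 2.\<close>

lemma rank_1_minors:
  fixes B :: "'a::field mat"
  assumes B: "B \<in> carrier_mat r r" and rank: "vec_space.rank r B = 1"
    and idx: "a < r" "b < r" "k < r" "l < r"
  shows "B $$ (k, l) * B $$ (a, b) = B $$ (k, b) * B $$ (a, l)"
proof (rule ccontr)
  assume ne: "\<not> ?thesis"
  interpret vec_space "TYPE('a)" r .
  let ?x = "col B l" and ?y = "col B b"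
  have xy: "?x \<in> carrier_vec r" "?y \<in> carrier_vec r" using B idx by auto
  have ent: "?x $ k = B $$ (k, l)" "?x $ a = B $$ (a, l)" "?y $ k = B $$ (k, b)" "?y $ a = B $$ (a, b)"
    using B idx by auto
  have dist: "?x \<noteq> ?y" using ne ent by (metis mult.commute)
  have "lin_indpt {?x, ?y}"
  proof (rule finite_lin_indpt2, goal_cases)
    case (3 f)
    have "lincomb f {?x, ?y} = f ?x \<cdot>\<^sub>v ?x + f ?y \<cdot>\<^sub>v ?y"
      using xy dist by (subst lincomb_def) (simp add: finsum_insert module_vec_simps)
    with 3(2) have 0: "f ?x \<cdot>\<^sub>v ?x + f ?y \<cdot>\<^sub>v ?y = 0\<^sub>v r" by (simp add: module_vec_simps)
    have k: "f ?x * ?x $ k + f ?y * ?y $ k = 0" and a: "f ?x * ?x $ a + f ?y * ?y $ a = 0"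
      using arg_cong[OF 0, of "\<lambda>v. v $ k"] arg_cong[OF 0, of "\<lambda>v. v $ a"] idx xy B by auto
    let ?d = "?x $ k * ?y $ a - ?y $ k * ?x $ a"
    have d: "?d \<noteq> 0" using ne by (simp add: ent)
    \<comment> \<open>Cramer's rule: each coefficient times the minor \<open>?d\<close> is a
      combination of the two vanishing coordinates \<open>k\<close> and \<open>a\<close>.\<close>
    have "f ?x * ?d = (f ?x * ?x $ k + f ?y * ?y $ k) * ?y $ a - (f ?x * ?x $ a + f ?y * ?y $ a) * ?y $ k"
      by (simp add: algebra_simps)
    moreover have "f ?y * ?d = (f ?x * ?x $ a + f ?y * ?y $ a) * ?x $ k - (f ?x * ?x $ k + f ?y * ?y $ k) * ?x $ a"
      by (simp add: algebra_simps)
    ultimately show ?case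
      using d unfolding k a by simp
  qed (use xy in \<open>auto simp: module_vec_simps\<close>)
  moreover have "{?x, ?y} \<subseteq> set (cols B)" using B idx by (auto simp: cols_def)
  ultimately have "card {?x, ?y} \<le> rank B" using rank_ge_card_indpt[OF B] by blast
  then show False using rank dist by simp
qed

text \<open>\<open>K\<close> packs the factors of the rank-one matrices and \<open>B 0\<close> into
  one bordered matrix: column \<open>i\<close> from row \<open>n\<close> on is the column factor,
  and row \<open>i\<close> from column \<open>n\<close> on the row factor, of
  \<open>B (Suc i)\<close>. It is a function on all indices, so that a working array with further
  columns can take its place.\<close>

locale bordered_pencil =
  fixes n r :: nat and A :: "'a::field mat" and B :: "nat \<Rightarrow> 'a mat" and K :: "nat \<Rightarrow> nat \<Rightarrow> 'a"
  assumes A: "A \<in> carrier_mat n n" and B0: "B 0 \<in> carrier_mat r r"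
    and pencil: "det_plus_Y n A = det (pencil n r B)"
    and K_zero: "\<And>i j. i < n \<Longrightarrow> j < n \<Longrightarrow> K i j = 0"
    and K_const: "\<And>a b. a < r \<Longrightarrow> b < r \<Longrightarrow> K (n + a) (n + b) = B 0 $$ (a, b)"
    and K_factor: "\<And>i a b. i < n \<Longrightarrow> a < r \<Longrightarrow> b < r \<Longrightarrow> B (Suc i) $$ (a, b) = K (n + a) i * K i (n + b)"
begin

definition U :: "'a mat" where "U = mat r n (\<lambda>(a, i). K (n + a) i)"
definition V :: "'a mat" where "V = mat n r (\<lambda>(i, b). K i (n + b))"

lemma carriers [simp]: "U \<in> carrier_mat r n" "V \<in> carrier_mat n r" "B 0 \<in> carrier_mat r r"
  "A \<in> carrier_mat n n" "dim_row (B 0) = r" "dim_col (B 0) = r" "dim_row A = n" "dim_col A = n"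
  using A B0 by (auto simp: U_def V_def)

lemma bordered_eq: "mat (n + r) (n + r) (\<lambda>(i, j). K i j) = four_block_mat (0\<^sub>m n n) V U (B 0)"
proof (rule eq_matI)
  fix i j
  assume "i < dim_row (four_block_mat (0\<^sub>m n n) V U (B 0))" "j < dim_col (four_block_mat (0\<^sub>m n n) V U (B 0))"
  then show "mat (n + r) (n + r) (\<lambda>(i, j). K i j) $$ (i, j) = four_block_mat (0\<^sub>m n n) V U (B 0) $$ (i, j)"
    using K_const[of "i - n" "j - n"] by (auto simp: U_def V_def K_zero)
qed auto

lemma pencil_eq: "pencil n r B = map_mat mconst (B 0) + map_mat mconst U * Ydiag n * map_mat mconst V"
proof -
  interpret mc: comm_ring_hom "mconst :: 'a \<Rightarrow> 'a mpoly" by (rule comm_ring_hom_mconst)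
  have Y: "Ydiag n \<in> carrier_mat n n" by (simp add: Ydiag_def)
  have "map_mat mconst U * Ydiag n = mat r n (\<lambda>(a, i). mconst (K (n + a) i) * mvar (Suc i))"
    unfolding Ydiag_def
    by (subst mat_diag_mult_right[of _ r]) (auto simp: U_def)
  then have ent: "(map_mat mconst U * Ydiag n * map_mat mconst V) $$ (a, b)
      = (\<Sum>i<n. mconst (B (Suc i) $$ (a, b)) * mvar (Suc i))" if "a < r" "b < r" for a b
    using that by (simp add: V_def scalar_prod_def K_factor mc.hom_mult ac_simps atLeast0LessThan)
  have shift: "(\<Sum>i = Suc 0..n. mconst (B i $$ (a, b)) * mvar i) = (\<Sum>i<n. mconst (B (Suc i) $$ (a, b)) * mvar (Suc i))" for a b
    by (rule sum.reindex_bij_witness[of _ Suc "\<lambda>i. i - 1"]) auto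
  show ?thesis
  proof (rule eq_matI)
    fix a b
    assume "a < dim_row (map_mat mconst (B 0) + map_mat mconst U * Ydiag n * map_mat mconst V)"
      "b < dim_col (map_mat mconst (B 0) + map_mat mconst U * Ydiag n * map_mat mconst V)"
    then have ab: "a < r" "b < r" by (simp_all add: U_def V_def)
    then show "pencil n r B $$ (a, b) = (map_mat mconst (B 0) + map_mat mconst U * Ydiag n * map_mat mconst V) $$ (a, b)"
      using ent[OF ab] by (simp add: pencil_def shift U_def V_def)
  qed (simp_all add: pencil_def U_def V_def)
qed

text \<open>With all variables replaced by \<open>t\<close>, the coefficient of \<open>t ^ n\<close>
  in the determinant of \<open>A\<close> plus \<open>t\<close> times the identity is 1. On the
  pencil side the same coefficient is, up to the sign in \<open>det_bordered\<close>, the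
  determinant of \<open>K\<close>. In particular \<open>K\<close> is invertible.\<close>

lemma det_bordered_pencil: "det (mat (n + r) (n + r) (\<lambda>(i, j). K i j)) = (-1) ^ n"
proof -
  interpret dp: comm_ring_hom "diag_poly :: 'a mpoly \<Rightarrow> 'a poly" by (rule comm_ring_hom_diag_poly)
  let ?c = "map_mat (\<lambda>x. [:x:]) :: 'a mat \<Rightarrow> 'a poly mat"
  let ?T = "mat_diag n (\<lambda>_. [:0, 1:]) :: 'a poly mat"
  have Y: "Ydiag n \<in> carrier_mat n n" by (simp add: Ydiag_def)
  have cc: "map_mat diag_poly (map_mat mconst M) = ?c M" for M :: "'a mat"
    by (auto intro!: eq_matI)
  have cY: "map_mat diag_poly (Ydiag n) = ?T"
    by (rule eq_matI) (auto simp: Ydiag_def mat_diag_def)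
  have add: "map_mat diag_poly (X + Z) = map_mat diag_poly X + map_mat diag_poly Z"
    if "X \<in> carrier_mat p q" "Z \<in> carrier_mat p q" for X Z :: "'a mpoly mat" and p q
    using that by (intro eq_matI) (auto simp: dp.hom_add)
  have m1: "map_mat diag_poly (map_mat mconst U * Ydiag n) = ?c U * ?T"
    using dp.mat_hom_mult[of "map_mat mconst U" r n "Ydiag n" n] Y by (simp add: cc cY)
  have UY: "map_mat mconst U * Ydiag n \<in> carrier_mat r n" by (rule mult_carrier_mat[OF _ Y]) simp
  have m2: "map_mat diag_poly (map_mat mconst U * Ydiag n * map_mat mconst V) = ?c U * ?T * ?c V"
    using dp.mat_hom_mult[of "map_mat mconst U * Ydiag n" r n "map_mat mconst V" r] UY by (simp add: cc m1)
  have "map_mat diag_poly (pencil n r B) = ?c (B 0) + ?c U * ?T * ?c V"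
    unfolding pencil_eq by (subst add[of _ r r]) (use UY in \<open>auto simp: cc m2\<close>)
  then have 1: "diag_poly (det (pencil n r B)) = det (?c (B 0) + ?c U * ?T * ?c V)"
    by (metis dp.hom_det)
  have "map_mat diag_poly (map_mat mconst A + Ydiag n) = ?c A + ?T"
    by (subst add[of _ n n]) (use Y in \<open>simp_all add: cc cY\<close>)
  then have 2: "diag_poly (det_plus_Y n A) = det (?c A + ?T)"
    unfolding det_plus_Y_def by (metis dp.hom_det)
  \<comment> \<open>Put all variables equal to \<open>t\<close> and compare the coefficients of \<open>t ^ n\<close>.\<close>
  have "coeff (det (?c A + ?T)) (sum (\<lambda>_. 1) {0..<n}) =
      det (mat n n (\<lambda>(i, j). coeff ((?c A + ?T) $$ (i, j)) 1))"
    by (intro coeff_det_degree_le) (auto simp: mat_diag_def)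
  moreover have "mat n n (\<lambda>(i, j). coeff ((?c A + ?T) $$ (i, j)) 1) = 1\<^sub>m n"
    by (intro eq_matI) (auto simp: mat_diag_def)
  ultimately have 3: "coeff (det (?c A + ?T)) n = 1" by simp
  let ?M = "four_block_mat (- 1\<^sub>m n) (?T * ?c V) (?c U) (?c (B 0))"
  \<comment> \<open>Row degree bounds: 1 in the first \<open>n\<close> rows, which carry
    \<open>t\<close>, and 0 in the others. At these degrees the constant block
    \<open>- 1\<^sub>m n\<close> drops out, which leaves the zero block of \<open>K\<close>.\<close>
  let ?d = "\<lambda>i. if i < n then 1 else 0 :: nat"
  have TV: "?T * ?c V = mat n r (\<lambda>(i, b). [:0, K i (n + b):])"
    by (subst mat_diag_mult_left[of _ n r]) (auto simp: V_def)
  have sumd: "sum ?d {0..<n + r} = n"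
  proof -
    have "sum ?d {0..<n + r} = sum ?d {0..<n}" by (rule sum.mono_neutral_right) auto
    then show ?thesis by simp
  qed
  have "coeff (det ?M) (sum ?d {0..<n + r}) = det (mat (n + r) (n + r) (\<lambda>(i, j). coeff (?M $$ (i, j)) (?d i)))"
    unfolding TV by (intro coeff_det_degree_le) (auto simp: U_def)
  moreover have "mat (n + r) (n + r) (\<lambda>(i, j). coeff (?M $$ (i, j)) (?d i)) = mat (n + r) (n + r) (\<lambda>(i, j). K i j)"
    unfolding bordered_eq TV by (intro eq_matI) (auto simp: U_def V_def)
  ultimately have "det (mat (n + r) (n + r) (\<lambda>(i, j). K i j)) = coeff (det ?M) n"
    unfolding sumd by simp
  also have "det ?M = (-1) ^ n * det (?c (B 0) + ?c U * ?T * ?c V)"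
    by (rule det_bordered) auto
  also have "\<dots> = [:(-1) ^ n:] * det (?c A + ?T)"
  proof -
    have "(-1) ^ n = [:(-1) ^ n :: 'a:]" by (induction n) (auto simp: one_pCons)
    then show ?thesis using 1 2 pencil by simp
  qed
  finally show ?thesis using 3 by simp
qed

text \<open>Elimination provides a left inverse \<open>L\<close>; as the matrices are square it is
  also a right inverse, and after lifting to polynomial entries
  \<open>det_diag_minus_inverse_block\<close> applies.\<close>

lemma det_plus_Y_inverse:
  assumes L: "\<And>i j. i < n + r \<Longrightarrow> j < n + r \<Longrightarrow> (\<Sum>k<n + r. L i k * K k j) = (if i = j then 1 else 0)"
  shows "det_plus_Y n A = det_plus_Y n (mat n n (\<lambda>(i, j). - L i j))"
proof -
  interpret mc: comm_ring_hom "mconst :: 'a \<Rightarrow> 'a mpoly" by (rule comm_ring_hom_mconst)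
  let ?K = "four_block_mat (0\<^sub>m n n) V U (B 0)"
  let ?m = "map_mat mconst :: 'a mat \<Rightarrow> 'a mpoly mat"
  define L11 L12 L21 L22 where "L11 = mat n n (\<lambda>(i, j). L i j)" and "L12 = mat n r (\<lambda>(i, j). L i (n + j))"
    and "L21 = mat r n (\<lambda>(i, j). L (n + i) j)" and "L22 = mat r r (\<lambda>(i, j). L (n + i) (n + j))"
  have LC: "L11 \<in> carrier_mat n n" "L12 \<in> carrier_mat n r" "L21 \<in> carrier_mat r n" "L22 \<in> carrier_mat r r"
    by (simp_all add: L11_def L12_def L21_def L22_def)
  let ?L = "four_block_mat L11 L12 L21 L22"
  have KC: "?K \<in> carrier_mat (n + r) (n + r)" and LL: "?L \<in> carrier_mat (n + r) (n + r)"
    using LC by auto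
  have Leq: "?L = mat (n + r) (n + r) (\<lambda>(i, j). L i j)"
    by (rule eq_matI) (auto simp: L11_def L12_def L21_def L22_def)
  have LK: "?L * ?K = 1\<^sub>m (n + r)"
    unfolding bordered_eq[symmetric] Leq
    by (rule eq_matI) (auto simp: scalar_prod_def atLeast0LessThan L)
  then have KL: "?K * ?L = 1\<^sub>m (n + r)"
    by (rule mat_mult_left_right_inverse[OF LL KC])
  have "det ?L * det ?K = 1" using det_mult[OF LL KC] LK by simp
  \<comment> \<open>The determinant of the inverse cancels the sign in the block identity.\<close>
  then have detL: "det ?L * (-1) ^ n = 1" using det_bordered_pencil by (simp add: bordered_eq)
  have mK: "?m ?K = four_block_mat (0\<^sub>m n n) (?m V) (?m U) (?m (B 0))"
    by (subst map_four_block_mat[of _ n n _ r _ r]) auto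
  have mL: "?m ?L = four_block_mat (?m L11) (?m L12) (?m L21) (?m L22)"
    using LC by (subst map_four_block_mat[of _ n n _ r _ r]) auto
  have "?m ?K * ?m ?L = 1\<^sub>m (n + r)"
    using mc.mat_hom_mult[OF KC LL] KL by (simp add: mc.mat_hom_one)
  then have inv: "four_block_mat (0\<^sub>m n n) (?m V) (?m U) (?m (B 0)) *
      four_block_mat (?m L11) (?m L12) (?m L21) (?m L22) = 1\<^sub>m (n + r)"
    unfolding mK mL .
  have "det (- ?m L11 + Ydiag n) = (-1) ^ n * det (pencil n r B) * det (?m ?L)"
    unfolding pencil_eq mL
    by (rule det_diag_minus_inverse_block[OF _ _ _ _ _ _ _ _ inv]) (use LC in \<open>auto simp: Ydiag_def\<close>)
  also have "\<dots> = det (pencil n r B) * mconst (det ?L * (-1) ^ n)"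
    by (simp add: mc.hom_mult mc.hom_power mc.hom_uminus mc.hom_det ac_simps)
  also have "\<dots> = det_plus_Y n A" unfolding detL by (simp add: pencil)
  finally have "det_plus_Y n A = det (- ?m L11 + Ydiag n)" by simp
  moreover have "- ?m L11 = ?m (mat n n (\<lambda>(i, j). - L i j))"
    by (rule eq_matI) (auto simp: L11_def mc.hom_uminus)
  ultimately show ?thesis by (simp add: det_plus_Y_def)
qed

end

subsection \<open>Reasoning about programs and their cost\<close>

text \<open>Syntactic frame sets, one for each sort of storage; by \<open>exec_unchanged\<close>
  everything outside them survives execution.\<close>

primrec nmods :: "com \<Rightarrow> string set" where
  "nmods Skip = {}"
| "nmods (NSet x e) = {x}"
| "nmods (FSet X is e) = {}"
| "nmods (Query X is Z) = {}"
| "nmods (Seq c1 c2) = nmods c1 \<union> nmods c2"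
| "nmods (Cond b c1 c2) = nmods c1 \<union> nmods c2"
| "nmods (While b c) = nmods c"

primrec fmods :: "com \<Rightarrow> string set" where
  "fmods Skip = {}"
| "fmods (NSet x e) = {}"
| "fmods (FSet X is e) = {X}"
| "fmods (Query X is Z) = {X}"
| "fmods (Seq c1 c2) = fmods c1 \<union> fmods c2"
| "fmods (Cond b c1 c2) = fmods c1 \<union> fmods c2"
| "fmods (While b c) = fmods c"

definition unchanged :: "string set \<Rightarrow> string set \<Rightarrow> 'a state \<Rightarrow> 'a state \<Rightarrow> bool" where
  "unchanged V F s s' \<longleftrightarrow>
     (\<forall>y. y \<notin> V \<longrightarrow> nvars s' y = nvars s y) \<and> (\<forall>X. X \<notin> F \<longrightarrow> arrs s' X = arrs s X)"

lemma unchangedD: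
  assumes "unchanged V F s s'"
  shows "y \<notin> V \<Longrightarrow> nvars s' y = nvars s y" and "X \<notin> F \<Longrightarrow> arrs s' X = arrs s X"
  using assms by (auto simp: unchanged_def)

lemma exec_unchanged: "exec h c s t s' \<Longrightarrow> unchanged (nmods c) (fmods c) s s'"
  by (induction rule: exec.induct) (auto simp: unchanged_def store_def)

text \<open>Total correctness with a budget: \<open>T\<close> only bounds the cost from above, so
  that branches of different cost can share it.\<close>

definition runs :: "((nat \<Rightarrow> 'a::field) \<Rightarrow> 'a) \<Rightarrow> com \<Rightarrow> nat \<Rightarrow> 'a state \<Rightarrow> ('a state \<Rightarrow> bool) \<Rightarrow> bool" where
  "runs h c T s Q \<longleftrightarrow> (\<exists>t s'. exec h c s t s' \<and> t \<le> T \<and> Q s')"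

lemma runs_weaken:
  assumes "runs h c T s Q" "T \<le> T'"
    "\<And>s'. unchanged (nmods c) (fmods c) s s' \<Longrightarrow> Q s' \<Longrightarrow> Q' s'"
  shows "runs h c T' s Q'"
proof -
  obtain t s' where t: "exec h c s t s'" "t \<le> T" "Q s'"
    using assms(1) by (auto simp: runs_def)
  then show ?thesis
    unfolding runs_def using assms(2) assms(3)[OF exec_unchanged[OF t(1)]]
    by (intro exI[of _ t] exI[of _ s']) auto
qed

lemma runs_Skip: "Q s \<Longrightarrow> 1 \<le> T \<Longrightarrow> runs h Skip T s Q"
  unfolding runs_def using exec.Skip by blast

lemma runs_FSet:
  "Q (store X (neval_list is s) (feval e s) s) \<Longrightarrow> 1 + ncost_list is s + fcost e s \<le> T
    \<Longrightarrow> runs h (FSet X is e) T s Q"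
  unfolding runs_def using exec.FSet by blast

lemma runs_Seq:
  assumes "runs h c1 T1 s R"
    and "\<And>s'. unchanged (nmods c1) (fmods c1) s s' \<Longrightarrow> R s' \<Longrightarrow> runs h c2 T2 s' Q"
  shows "runs h (Seq c1 c2) (T1 + T2) s Q"
proof -
  obtain t1 s1 where 1: "exec h c1 s t1 s1" "t1 \<le> T1" "R s1"
    using assms(1) by (auto simp: runs_def)
  obtain t2 s2 where 2: "exec h c2 s1 t2 s2" "t2 \<le> T2" "Q s2"
    using assms(2)[OF exec_unchanged[OF 1(1)] 1(3)] by (auto simp: runs_def)
  show ?thesis
    unfolding runs_def using exec.Seq[OF 1(1) 2(1)] 1(2) 2(2,3) by (intro exI conjI) auto
qed

lemma runs_Cond:
  assumes "beval b s \<Longrightarrow> runs h c1 T s Q" and "\<not> beval b s \<Longrightarrow> runs h c2 T s Q"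
    and "1 + bcost b s \<le> D"
  shows "runs h (Cond b c1 c2) (D + T) s Q"
proof (cases "beval b s")
  case True
  then obtain t s' where t: "exec h c1 s t s'" "t \<le> T" "Q s'"
    using assms(1) by (auto simp: runs_def)
  show ?thesis
    unfolding runs_def using exec.CondTrue[OF True t(1)] t(2,3) assms(3)
    by (intro exI conjI) auto
next
  case False
  then obtain t s' where t: "exec h c2 s t s'" "t \<le> T" "Q s'"
    using assms(2) by (auto simp: runs_def)
  show ?thesis
    unfolding runs_def using exec.CondFalse[OF False t(1)] t(2,3) assms(3)
    by (intro exI conjI) auto
qed

section \<open>Counting loops and their cost\<close>

definition For :: "string \<Rightarrow> nexp \<Rightarrow> com \<Rightarrow> com" where
  "For x e c = Seq (NSet x (NConst 0))
     (While (BLess (NVar x) e) (Seq c (NSet x (NPlus (NVar x) (NConst 1)))))"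

lemma mods_For [simp]: "nmods (For x e c) = insert x (nmods c)" "fmods (For x e c) = fmods c"
  by (auto simp: For_def)

text \<open>\<open>D\<close> bounds the number of rounds, the counter and the cost of the loop
  limit, \<open>T\<close> the cost of the body. A round costs at most \<open>T + 3 * D + 10\<close>
  including test and increment; the last test takes at most \<open>2 * D + 3\<close> and the
  initialisation 2.\<close>

definition loop_cost :: "nat \<Rightarrow> nat \<Rightarrow> nat" where
  "loop_cost D T = D * (T + 3 * D + 10) + 2 * D + 5"

text \<open>The invariant speaks of the round number and the arrays only; natural number variables
  are recovered from the frame, and \<open>x \<notin> nmods c\<close> protects the counter. The
  limit \<open>e\<close> is evaluated anew in every round and therefore has to keep its value
  throughout.\<close>

lemma runs_For:
  fixes s :: "'a::field state"
  assumes x: "x \<notin> nmods c"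
    and e: "\<And>s'. unchanged (insert x (nmods c)) (fmods c) s s' \<Longrightarrow> neval e s' = m \<and> ncost e s' \<le> D"
    and mD: "m \<le> D"
    and init: "I 0 (arrs s)"
    and step: "\<And>k s'. k < m \<Longrightarrow> unchanged (insert x (nmods c)) (fmods c) s s' \<Longrightarrow> nvars s' x = k \<Longrightarrow>
      I k (arrs s') \<Longrightarrow> runs h c T s' (\<lambda>s''. I (Suc k) (arrs s''))"
  shows "runs h (For x e c) (loop_cost D T) s (\<lambda>s'. I m (arrs s'))"
proof -
  let ?U = "unchanged (insert x (nmods c)) (fmods c)"
  let ?inc = "NSet x (NPlus (NVar x) (NConst 1))"
  let ?w = "While (BLess (NVar x) e) (Seq c ?inc)"
  have loop: "\<exists>t s''. exec h ?w s' t s'' \<and> t \<le> (m - k) * (T + 3 * D + 10) + 2 * D + 3 \<and> I m (arrs s'')"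
    if "k \<le> m" "?U s s'" "nvars s' x = k" "I k (arrs s')" for k s'
    using that
  proof (induction "m - k" arbitrary: k s')
    case 0
    then have k: "k = m" by simp
    have "exec h ?w s' (1 + bcost (BLess (NVar x) e) s') s'"
      using e[OF 0(3)] 0 k by (intro exec.WhileFalse) simp
    then show ?case
      using e[OF 0(3)] 0 k mD by (intro exI conjI) auto
  next
    case (Suc d)
    then have k: "k < m" by simp
    obtain t1 s1 where 1: "exec h c s' t1 s1" "t1 \<le> T" "I (Suc k) (arrs s1)"
      using step[OF k Suc.prems(2,3,4)] by (auto simp: runs_def)
    have U1: "unchanged (nmods c) (fmods c) s' s1" using exec_unchanged[OF 1(1)] .
    have x1: "nvars s1 x = k" using unchangedD(1)[OF U1 x] Suc.prems by simp
    define s2 where "s2 = s1\<lparr>nvars := (nvars s1)(x := Suc k)\<rparr>"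
    have body: "exec h (Seq c ?inc) s' (t1 + (5 + k)) s2"
      using exec.Seq[OF 1(1) exec.NSet[of h x "NPlus (NVar x) (NConst 1)" s1]] x1
      by (simp add: s2_def eval_nat_numeral)
    have U2: "?U s s2"
      using Suc.prems(2) U1 by (auto simp: unchanged_def s2_def)
    obtain t s'' where t: "exec h ?w s2 t s''" "t \<le> (m - Suc k) * (T + 3 * D + 10) + 2 * D + 3"
        "I m (arrs s'')"
    proof -
      have "d = m - Suc k" "Suc k \<le> m" using Suc.hyps(2) by auto
      moreover have "nvars s2 x = Suc k" "I (Suc k) (arrs s2)" using 1(3) by (auto simp: s2_def)
      ultimately show ?thesis using Suc.hyps(1)[of "Suc k" s2] U2 that by blast
    qed
    have b: "beval (BLess (NVar x) e) s'" using e[OF Suc.prems(2)] Suc.prems k by simp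
    have "exec h ?w s' (1 + bcost (BLess (NVar x) e) s' + (t1 + (5 + k)) + t) s''"
      by (rule exec.WhileTrue[OF b body t(1)])
    moreover have "1 + bcost (BLess (NVar x) e) s' + (t1 + (5 + k)) + t
        \<le> (T + 3 * D + 10) + ((m - Suc k) * (T + 3 * D + 10) + 2 * D + 3)"
      using e[OF Suc.prems(2)] Suc.prems k 1(2) t(2) mD by simp
    moreover have "m - k = Suc (m - Suc k)" using k by simp
    ultimately show ?case using t(3) by (intro exI[of _ s''] exI conjI) auto
  qed
  define s0 where "s0 = s\<lparr>nvars := (nvars s)(x := 0)\<rparr>"
  have init': "exec h (NSet x (NConst 0)) s 2 s0"
    using exec.NSet[of h x "NConst 0" s] by (simp add: s0_def numeral_2_eq_2)
  have "?U s s0" by (auto simp: unchanged_def s0_def)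
  then obtain t s'' where t: "exec h ?w s0 t s''" "t \<le> m * (T + 3 * D + 10) + 2 * D + 3"
      "I m (arrs s'')"
    using loop[of 0 s0] init by (auto simp: s0_def)
  have "exec h (For x e c) s (2 + t) s''"
    unfolding For_def by (rule exec.Seq[OF init' t(1)])
  moreover have "m * (T + 3 * D + 10) \<le> D * (T + 3 * D + 10)" using mD by (rule mult_le_mono1)
  then have "2 + t \<le> loop_cost D T"
    using t(2) unfolding loop_cost_def by linarith
  ultimately show ?thesis using t(3) by (auto simp: runs_def)
qed

subsection \<open>Gauss--Jordan elimination\<close>

text \<open>\<open>M\<close> is an \<open>N \<times> 2N\<close> matrix \<open>[E K | E]\<close> with \<open>E\<close> invertible, whose first \<open>c\<close> columns are
  already diagonal. Invertibility is stated as triviality of the kernel of the left half.\<close>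

definition reduced :: "nat \<Rightarrow> (nat \<Rightarrow> nat \<Rightarrow> 'a::field) \<Rightarrow> nat \<Rightarrow> (nat \<Rightarrow> nat \<Rightarrow> 'a) \<Rightarrow> bool" where
  "reduced N K c M \<longleftrightarrow>
     (\<forall>i<N. \<forall>j<N. M i j = (\<Sum>k<N. M i (N + k) * K k j)) \<and>
     (\<forall>x. (\<forall>i<N. (\<Sum>j<N. M i j * x j) = 0) \<longrightarrow> (\<forall>j<N. x j = 0)) \<and>
     (\<forall>i<N. \<forall>j<c. i \<noteq> j \<longrightarrow> M i j = 0)"

lemma reducedD:
  assumes "reduced N K c M"
  shows "i < N \<Longrightarrow> j < N \<Longrightarrow> (\<Sum>k<N. M i (N + k) * K k j) = M i j"
    and "(\<And>i. i < N \<Longrightarrow> (\<Sum>j<N. M i j * x j) = 0) \<Longrightarrow> j < N \<Longrightarrow> x j = 0"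
    and "i < N \<Longrightarrow> j < c \<Longrightarrow> i \<noteq> j \<Longrightarrow> M i j = 0"
proof -
  note a = assms[unfolded reduced_def]
  show "i < N \<Longrightarrow> j < N \<Longrightarrow> (\<Sum>k<N. M i (N + k) * K k j) = M i j"
    using a by metis
  show "(\<And>i. i < N \<Longrightarrow> (\<Sum>j<N. M i j * x j) = 0) \<Longrightarrow> j < N \<Longrightarrow> x j = 0"
    using a by blast
  show "i < N \<Longrightarrow> j < c \<Longrightarrow> i \<noteq> j \<Longrightarrow> M i j = 0"
    using a by blast
qed

text \<open>As \<open>a \<noteq> b\<close>, the row operation is left multiplication by an
  invertible matrix, which preserves both the relation between the halves and the trivial kernel.
  Since \<open>c \<le> b\<close>, row \<open>b\<close> vanishes in the columns below
  \<open>c\<close>, so no diagonal column is spoilt.\<close>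

lemma reduced_add_row:
  assumes red: "reduced N K c M" and ab: "a < N" "b < N" "a \<noteq> b" "c \<le> b"
    and M': "\<And>i j. M' i j = M i j + (if i = a \<and> j < N + N then f * M b j else 0)"
  shows "reduced N K c M'"
proof -
  have "M' i j = (\<Sum>k<N. M' i (N + k) * K k j)" if "i < N" "j < N" for i j
  proof -
    have "(\<Sum>k<N. M' i (N + k) * K k j) = (\<Sum>k<N. M i (N + k) * K k j) +
        (if i = a then f * (\<Sum>k<N. M b (N + k) * K k j) else 0)"
      by (simp add: M' distrib_right sum.distrib sum_distrib_left mult.assoc)
    then show ?thesis using that ab by (simp add: reducedD(1)[OF red] M')
  qed
  moreover have "x l = 0" if x: "\<forall>i<N. (\<Sum>j<N. M' i j * x j) = 0" and l: "l < N" for x l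
  proof -
    \<comment> \<open>Row \<open>b\<close> is unchanged because \<open>a \<noteq> b\<close>, so its
      equation can be subtracted from that of row \<open>a\<close>.\<close>
    have b: "(\<Sum>j<N. M b j * x j) = 0" using x ab by (auto simp: M')
    have "(\<Sum>j<N. M i j * x j) = 0" if "i < N" for i
    proof (cases "i = a")
      case True
      have "0 = (\<Sum>j<N. M' a j * x j)" using x ab by simp
      also have "\<dots> = (\<Sum>j<N. M a j * x j) + f * (\<Sum>j<N. M b j * x j)"
        unfolding sum_distrib_left sum.distrib[symmetric]
        by (intro sum.cong) (auto simp: M' algebra_simps)
      finally show ?thesis using b True by simp
    qed (use x that in \<open>auto simp: M'\<close>)
    then show ?thesis using reducedD(2)[OF red, of x] l by blast
  qed
  moreover have "M' i j = 0" if "i < N" "j < c" "i \<noteq> j" for i j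
    using that ab by (auto simp: M' reducedD(3)[OF red])
  ultimately show ?thesis unfolding reduced_def by blast
qed

text \<open>Otherwise the unit vector \<open>j\<close> would lie in the kernel, column
  \<open>j\<close> having no nonzero entries off the diagonal.\<close>

lemma reduced_diag_nonzero:
  assumes red: "reduced N K c M" and j: "j < c" "c \<le> N"
  shows "M j j \<noteq> 0"
proof
  assume 0: "M j j = 0"
  have "M i l * (if l = j then 1 else 0) = 0" if "i < N" for i l
    using that j 0 reducedD(3)[OF red that j(1)] by auto
  then have "(\<Sum>l<N. M i l * (if l = j then 1 else 0)) = 0" if "i < N" for i
    using that by (intro sum.neutral) blast
  then have "(if j = j then 1 else 0) = (0::'a)"
    by (rule reducedD(2)[OF red]) (use j in auto)
  then show False by simp
qed

text \<open>If column \<open>c\<close> vanished from row \<open>c\<close> on, it would be a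
  combination of the earlier columns, against the trivial kernel.\<close>

lemma reduced_pivot_exists:
  assumes red: "reduced N K c M" and c: "c < N"
  shows "\<exists>p. c \<le> p \<and> p < N \<and> M p c \<noteq> 0"
proof (rule ccontr)
  assume contr: "\<not> ?thesis"
  \<comment> \<open>The kernel vector: the entry 1 at position \<open>c\<close> forces the earlier
    entries through the diagonal equations, and the later ones are set to 0.\<close>
  define x where "x l = (if l = c then 1 else if l < c then - M l c / M l l else 0)" for l
  have "(\<Sum>l<N. M i l * x l) = 0" if i: "i < N" for i
  proof -
    have 0: "M i l * x l = 0" if "l \<noteq> i" "l \<noteq> c" for l
      using that i by (auto simp: reducedD(3)[OF red] x_def)
    show ?thesis
    proof (cases "i < c")
      case True
      have "(\<Sum>l<N. M i l * x l) = (\<Sum>l\<in>{i, c}. M i l * x l)"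
        by (rule sum.mono_neutral_right) (use i c 0 in auto)
      also have "\<dots> = 0"
        using True reduced_diag_nonzero[OF red True] c by (simp add: x_def)
      finally show ?thesis .
    next
      case False
      have "M i l * x l = 0" for l
        using 0[of l] contr False i by (cases "l = c") (auto simp: x_def)
      then show ?thesis by simp
    qed
  qed
  then have "x c = 0" by (rule reducedD(2)[OF red]) (use c in auto)
  then show False by (simp add: x_def)
qed

text \<open>The left half is diagonal, so dividing each row by its diagonal entry turns the right
  half into a left inverse of \<open>K\<close>. Elimination adds rows but never scales one, hence
  the normalisation here.\<close>

lemma reduced_inverse:
  assumes red: "reduced N K N M" and ij: "i < N" "j < N"
  shows "(\<Sum>k<N. M i (N + k) / M i i * K k j) = (if i = j then 1 else 0)"
proof -
  have "(\<Sum>k<N. M i (N + k) / M i i * K k j) = (\<Sum>k<N. M i (N + k) * K k j) / M i i"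
    by (simp add: sum_divide_distrib)
  also have "\<dots> = M i j / M i i" by (simp only: reducedD(1)[OF red ij])
  also have "\<dots> = (if i = j then 1 else 0)"
    using ij reduced_diag_nonzero[OF red ij(1)] by (auto simp: reducedD(3)[OF red])
  finally show ?thesis .
qed

subsection \<open>The program\<close>

definition dim_exp :: nexp where
  "dim_exp = NPlus (NVar ''n'') (NVar ''r'')"

text \<open>The factor sits in an array at the empty index, as there are no scalar field variables.
  It is stored beforehand because the loop overwrites entries from which it may have been
  computed.\<close>

definition add_row :: "string \<Rightarrow> string \<Rightarrow> com" where
  "add_row x y = For ''j'' (NPlus dim_exp dim_exp)
     (FSet ''W'' [NVar x, NVar ''j''] (FPlus (FGet ''W'' [NVar x, NVar ''j''])
        (FTimes (FGet ''f'' []) (FGet ''W'' [NVar y, NVar ''j'']))))"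

text \<open>Adding rows below the diagonal until the pivot is nonzero replaces the usual row exchange.\<close>

definition make_pivot :: com where
  "make_pivot = For ''p'' dim_exp
     (Cond (BAnd (BLess (NVar ''c'') (NVar ''p'')) (BEq (FGet ''W'' [NVar ''c'', NVar ''c'']) FZero))
       (Seq (FSet ''f'' [] FOne) (add_row ''c'' ''p'')) Skip)"

text \<open>Rows above and below the pivot are cleared. The test says that \<open>i\<close> and
  \<open>c\<close> differ; it is built from \<open>BLess\<close> because \<open>BEq\<close> compares
  field elements.\<close>

definition clear_column :: com where
  "clear_column = For ''i'' dim_exp
     (Cond (BNot (BAnd (BNot (BLess (NVar ''i'') (NVar ''c''))) (BNot (BLess (NVar ''c'') (NVar ''i'')))))
       (Seq (FSet ''f'' [] (FMinus FZero
               (FDivide (FGet ''W'' [NVar ''i'', NVar ''c'']) (FGet ''W'' [NVar ''c'', NVar ''c'']))))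
          (add_row ''i'' ''c'')) Skip)"

definition eliminate :: com where
  "eliminate = For ''c'' dim_exp (Seq make_pivot clear_column)"

text \<open>Given a nonzero entry at \<open>a\<close>, \<open>b\<close>, a rank-one matrix is its
  column \<open>b\<close> times its row \<open>a\<close> divided by that entry. The row factor goes
  into row \<open>i\<close> of \<open>W\<close>, the column factor into column
  \<open>i\<close>.\<close>

definition store_factors :: com where
  "store_factors = For ''k'' (NVar ''r'')
     (Seq (FSet ''W'' [NVar ''i'', NPlus (NVar ''n'') (NVar ''k'')]
            (FDivide (FGet ''B'' [NPlus (NVar ''i'') (NConst 1), NVar ''a'', NVar ''k''])
               (FGet ''B'' [NPlus (NVar ''i'') (NConst 1), NVar ''a'', NVar ''b''])))
          (FSet ''W'' [NPlus (NVar ''n'') (NVar ''k''), NVar ''i'']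
            (FGet ''B'' [NPlus (NVar ''i'') (NConst 1), NVar ''k'', NVar ''b''])))"

definition factor_at :: com where
  "factor_at = Cond (BNot (BEq (FGet ''B'' [NPlus (NVar ''i'') (NConst 1), NVar ''a'', NVar ''b'']) FZero))
     store_factors Skip"

text \<open>All positions are tried without stopping at the first nonzero entry: each later one
  overwrites the factors by another valid pair.\<close>

definition load_factors :: com where
  "load_factors = For ''i'' (NVar ''n'') (For ''a'' (NVar ''r'') (For ''b'' (NVar ''r'') factor_at))"

definition load_constant :: com where
  "load_constant = For ''i'' (NVar ''r'') (For ''k'' (NVar ''r'')
     (FSet ''W'' [NPlus (NVar ''n'') (NVar ''i''), NPlus (NVar ''n'') (NVar ''k'')]
        (FGet ''B'' [NConst 0, NVar ''i'', NVar ''k''])))"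

definition load_identity :: com where
  "load_identity = For ''i'' dim_exp (FSet ''W'' [NVar ''i'', NPlus dim_exp (NVar ''i'')] FOne)"

definition write_output :: com where
  "write_output = For ''i'' (NVar ''n'') (For ''j'' (NVar ''n'')
     (FSet ''A'' [NVar ''i'', NVar ''j''] (FMinus FZero
        (FDivide (FGet ''W'' [NVar ''i'', NPlus dim_exp (NVar ''j'')]) (FGet ''W'' [NVar ''i'', NVar ''i''])))))"

definition diag_prog :: com where
  "diag_prog = Seq load_factors (Seq load_constant (Seq load_identity (Seq eliminate write_output)))"

lemmas eval_simps = dim_exp_def neval_list_def ncost_list_def store_def

subsection \<open>Correctness of the program\<close>

text \<open>One generous bound for all loop lengths, loop limits, tests and single assignments; the
  longest loop runs over \<open>2 * (n + r)\<close> columns.\<close>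

abbreviation ops_bound :: "nat \<Rightarrow> nat \<Rightarrow> nat" where
  "ops_bound n r \<equiv> 100 * (n + r + 1)"

section \<open>Correctness of the elimination stages\<close>

lemma runs_add_row:
  fixes s :: "'a::field state"
  assumes s: "nvars s ''n'' = n" "nvars s ''r'' = r" "nvars s x = a" "nvars s y = b"
    and ab: "a < n + r" "b < n + r" "a \<noteq> b" and xy: "x \<noteq> ''j''" "y \<noteq> ''j''"
    and D: "D = ops_bound n r"
  shows "runs h (add_row x y) (loop_cost D D) s (\<lambda>s'. \<forall>i j. arrs s' ''W'' [i, j] =
    arrs s ''W'' [i, j] + (if i = a \<and> j < (n + r) + (n + r) then arrs s ''f'' [] * arrs s ''W'' [b, j] else 0))"
proof -
  let ?I = "\<lambda>k ar. \<forall>i j. ar ''W'' [i, j] =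
    arrs s ''W'' [i, j] + (if i = a \<and> j < k then arrs s ''f'' [] * arrs s ''W'' [b, j] else 0)"
  show ?thesis
    unfolding add_row_def
  proof (rule runs_For[where I = ?I], goal_cases)
    case (5 k s')
    then have v: "nvars s' x = a" "nvars s' y = b" "arrs s' ''f'' = arrs s ''f''"
      using unchangedD[OF 5(2)] s xy by auto
    show ?case
      by (rule runs_FSet) (use v 5 ab D in \<open>auto simp: eval_simps less_Suc_eq\<close>)
  qed (use s xy D in \<open>auto simp: eval_simps unchanged_def\<close>)
qed

lemma runs_make_pivot:
  fixes s :: "'a::field state"
  assumes s: "nvars s ''n'' = n" "nvars s ''r'' = r" "nvars s ''c'' = c" and c: "c < n + r"
    and D: "D = ops_bound n r"
    and red: "reduced (n + r) K c (\<lambda>i j. arrs s ''W'' [i, j])"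
  shows "runs h make_pivot (loop_cost D (D + (D + loop_cost D D))) s
    (\<lambda>s'. reduced (n + r) K c (\<lambda>i j. arrs s' ''W'' [i, j]) \<and> arrs s' ''W'' [c, c] \<noteq> 0)"
proof -
  \<comment> \<open>Any nonzero entry passed so far below position \<open>c\<close> ensures a
    nonzero pivot. At the end \<open>reduced_pivot_exists\<close> provides such an entry unless the
    pivot itself is nonzero.\<close>
  let ?I = "\<lambda>p ar. reduced (n + r) K c (\<lambda>i j. ar ''W'' [i, j]) \<and>
    (\<forall>q<p. c < q \<longrightarrow> ar ''W'' [q, c] \<noteq> 0 \<longrightarrow> ar ''W'' [c, c] \<noteq> 0)"
  have "runs h make_pivot (loop_cost D (D + (D + loop_cost D D))) s (\<lambda>s'. ?I (n + r) (arrs s'))"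
    unfolding make_pivot_def
  proof (rule runs_For[where I = ?I], goal_cases)
    case (5 p s')
    have v: "nvars s' ''n'' = n" "nvars s' ''r'' = r" "nvars s' ''c'' = c" "nvars s' ''p'' = p"
      using unchangedD[OF 5(2)] s 5(3) by (auto simp: add_row_def)
    have red': "reduced (n + r) K c (\<lambda>i j. arrs s' ''W'' [i, j])" using 5(4) by blast
    show ?case
    proof (rule runs_Cond, goal_cases)
      case 1
      then have cp: "c < p" and z: "arrs s' ''W'' [c, c] = 0" using v by (auto simp: eval_simps)
      show ?case
      proof (rule runs_Seq[where R = "\<lambda>s1. arrs s1 ''f'' [] = 1 \<and> arrs s1 ''W'' = arrs s' ''W''"], goal_cases)
        case 1
        then show ?case by (rule runs_FSet) (auto simp: eval_simps D)
      next
        case (2 s1)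
        have v1: "nvars s1 ''n'' = n" "nvars s1 ''r'' = r" "nvars s1 ''c'' = c" "nvars s1 ''p'' = p"
          using unchangedD[OF 2(1)] v by auto
        have cpne: "c \<noteq> p" using cp by simp
        show ?case
        proof (rule runs_weaken[OF runs_add_row[OF v1(1,2,3,4) c 5(1) cpne _ _ D] order_refl], goal_cases)
          case (3 s2)
          then have W: "arrs s2 ''W'' [i, j] = arrs s' ''W'' [i, j] +
              (if i = c \<and> j < (n + r) + (n + r) then 1 * arrs s' ''W'' [p, j] else 0)" for i j
            using 2 by simp
          have "reduced (n + r) K c (\<lambda>i j. arrs s2 ''W'' [i, j])"
            by (rule reduced_add_row[OF red' c 5(1) cpne _ W]) (use cp in simp)
          \<comment> \<open>With a zero pivot the invariant excludes rows before \<open>p\<close>,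
            so \<open>q = p\<close>, and the new pivot is the old entry of row
            \<open>p\<close>.\<close>
          moreover have "arrs s2 ''W'' [c, c] \<noteq> 0"
            if "q < Suc p" "c < q" "arrs s2 ''W'' [q, c] \<noteq> 0" for q
            using that z 5(4) c by (cases "q = p") (auto simp: W)
          ultimately show ?case by blast
        qed auto
      qed
    next
      case 2
      then show ?case
        by (intro runs_Skip) (use v 5(4) D in \<open>auto simp: eval_simps less_Suc_eq\<close>)
    next
      case 3
      then show ?case using v D 5(1) c by (simp add: eval_simps)
    qed
  qed (use s D red in \<open>auto simp: eval_simps unchanged_def add_row_def\<close>)
  then show ?thesis
  proof (rule runs_weaken[OF _ order_refl])
    fix s' :: "'a state"
    assume I: "?I (n + r) (arrs s')"
    then have red': "reduced (n + r) K c (\<lambda>i j. arrs s' ''W'' [i, j])" by blast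
    obtain p where "c \<le> p" "p < n + r" "arrs s' ''W'' [p, c] \<noteq> 0"
      using reduced_pivot_exists[OF red' c] by blast
    then have "arrs s' ''W'' [c, c] \<noteq> 0" using I by (cases "p = c") auto
    then show "reduced (n + r) K c (\<lambda>i j. arrs s' ''W'' [i, j]) \<and> arrs s' ''W'' [c, c] \<noteq> 0"
      using red' by blast
  qed
qed

lemma runs_clear_column:
  fixes s :: "'a::field state"
  assumes s: "nvars s ''n'' = n" "nvars s ''r'' = r" "nvars s ''c'' = c" and c: "c < n + r"
    and D: "D = ops_bound n r"
    and red: "reduced (n + r) K c (\<lambda>i j. arrs s ''W'' [i, j])"
    and pivot: "arrs s ''W'' [c, c] \<noteq> 0"
  shows "runs h clear_column (loop_cost D (D + (D + loop_cost D D))) s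
    (\<lambda>s'. reduced (n + r) K (Suc c) (\<lambda>i j. arrs s' ''W'' [i, j]))"
proof -
  \<comment> \<open>Row \<open>c\<close> is never a target, so the pivot stays nonzero while column
    \<open>c\<close> is emptied row by row.\<close>
  let ?I = "\<lambda>p ar. reduced (n + r) K c (\<lambda>i j. ar ''W'' [i, j]) \<and> ar ''W'' [c, c] \<noteq> 0 \<and>
    (\<forall>q<p. q \<noteq> c \<longrightarrow> ar ''W'' [q, c] = 0)"
  have "runs h clear_column (loop_cost D (D + (D + loop_cost D D))) s (\<lambda>s'. ?I (n + r) (arrs s'))"
    unfolding clear_column_def
  proof (rule runs_For[where I = ?I], goal_cases)
    case (5 p s')
    have v: "nvars s' ''n'' = n" "nvars s' ''r'' = r" "nvars s' ''c'' = c" "nvars s' ''i'' = p"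
      using unchangedD[OF 5(2)] s 5(3) by (auto simp: add_row_def)
    have red': "reduced (n + r) K c (\<lambda>i j. arrs s' ''W'' [i, j])" using 5(4) by blast
    show ?case
    proof (rule runs_Cond, goal_cases)
      case 1
      then have pc: "p \<noteq> c" using v by auto
      let ?f = "- (arrs s' ''W'' [p, c] / arrs s' ''W'' [c, c])"
      show ?case
      proof (rule runs_Seq[where R = "\<lambda>s1. arrs s1 ''f'' [] = ?f \<and> arrs s1 ''W'' = arrs s' ''W''"], goal_cases)
        case 1
        then show ?case by (rule runs_FSet) (use v c 5(1) in \<open>auto simp: eval_simps D\<close>)
      next
        case (2 s1)
        have v1: "nvars s1 ''n'' = n" "nvars s1 ''r'' = r" "nvars s1 ''c'' = c" "nvars s1 ''i'' = p"
          using unchangedD[OF 2(1)] v by auto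
        show ?case
        proof (rule runs_weaken[OF runs_add_row[OF v1(1,2,4,3) 5(1) c pc _ _ D] order_refl], goal_cases)
          case (3 s2)
          then have W: "arrs s2 ''W'' [i, j] = arrs s' ''W'' [i, j] +
              (if i = p \<and> j < (n + r) + (n + r) then ?f * arrs s' ''W'' [c, j] else 0)" for i j
            using 2 by simp
          have "reduced (n + r) K c (\<lambda>i j. arrs s2 ''W'' [i, j])"
            by (rule reduced_add_row[OF red' 5(1) c pc _ W]) simp
          moreover have "arrs s2 ''W'' [c, c] \<noteq> 0" using 5(4) pc by (auto simp: W)
          moreover have "arrs s2 ''W'' [q, c] = 0" if "q < Suc p" "q \<noteq> c" for q
            using that 5(4) c by (cases "q = p") (auto simp: W)
          ultimately show ?case by blast
        qed auto
      qed
    next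
      case 2
      then show ?case
        by (intro runs_Skip) (use v 5(4) D in \<open>auto simp: eval_simps less_Suc_eq\<close>)
    next
      case 3
      then show ?case using v D 5(1) c by (simp add: eval_simps)
    qed
  qed (use s D red pivot in \<open>auto simp: eval_simps unchanged_def add_row_def\<close>)
  \<comment> \<open>Once all rows have been visited, column \<open>c\<close> joins the diagonal
    ones.\<close>
  then show ?thesis
    by (rule runs_weaken[OF _ order_refl]) (unfold reduced_def less_Suc_eq, blast)
qed

lemma runs_eliminate:
  fixes s :: "'a::field state"
  assumes s: "nvars s ''n'' = n" "nvars s ''r'' = r"
    and D: "D = ops_bound n r"
    and red: "reduced (n + r) K 0 (\<lambda>i j. arrs s ''W'' [i, j])"
  shows "runs h eliminate (loop_cost D (loop_cost D (D + (D + loop_cost D D)) +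
      loop_cost D (D + (D + loop_cost D D)))) s
    (\<lambda>s'. reduced (n + r) K (n + r) (\<lambda>i j. arrs s' ''W'' [i, j]))"
  unfolding eliminate_def
proof (rule runs_For[where I = "\<lambda>c ar. reduced (n + r) K c (\<lambda>i j. ar ''W'' [i, j])"], goal_cases)
  case (5 c s')
  have v: "nvars s' ''n'' = n" "nvars s' ''r'' = r"
    using unchangedD[OF 5(2)] s by (auto simp: add_row_def make_pivot_def clear_column_def)
  show ?case
  proof (rule runs_Seq[OF runs_make_pivot[OF v 5(3,1) D 5(4)]], goal_cases)
    case (1 s1)
    then show ?case
      by (intro runs_clear_column)
        (use unchangedD[OF 1(1)] v 5 D in \<open>auto simp: add_row_def make_pivot_def\<close>)
  qed
qed (use s D red in \<open>auto simp: eval_simps unchanged_def make_pivot_def clear_column_def add_row_def\<close>)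

section \<open>Loading the bordered matrix into the working array\<close>

definition factored :: "nat \<Rightarrow> nat \<Rightarrow> (nat list \<Rightarrow> 'a::field) \<Rightarrow> (nat list \<Rightarrow> 'a) \<Rightarrow> nat \<Rightarrow> bool" where
  "factored n r B W i \<longleftrightarrow> (\<forall>a<r. \<forall>b<r. B [Suc i, a, b] = W [n + a, i] * W [i, n + b])"

text \<open>The support of \<open>W\<close> once the factors are loaded. The zeros elsewhere matter:
  the upper left block of \<open>K\<close> and the zeros of the right half are never written by the
  loading stages but inherited from the initial state.\<close>

definition bordered_shape :: "nat \<Rightarrow> nat \<Rightarrow> (nat list \<Rightarrow> 'a::zero) \<Rightarrow> bool" where
  "bordered_shape n r W \<longleftrightarrow> (\<forall>x y. \<not> (x < n \<and> n \<le> y \<and> y < n + r) \<longrightarrow>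
     \<not> (n \<le> x \<and> x < n + r \<and> y < n) \<longrightarrow> W [x, y] = 0)"

lemma runs_store_factors:
  fixes s :: "'a::field state"
  assumes s: "nvars s ''n'' = n" "nvars s ''r'' = r" "nvars s ''i'' = i" "nvars s ''a'' = a" "nvars s ''b'' = b"
    and bounds: "i < n" "a < r" "b < r" and D: "D = ops_bound n r"
  shows "runs h store_factors (loop_cost D (D + D)) s (\<lambda>s'. \<forall>x y. arrs s' ''W'' [x, y] =
    (if x = i \<and> n \<le> y \<and> y < n + r then arrs s ''B'' [Suc i, a, y - n] / arrs s ''B'' [Suc i, a, b]
     else if y = i \<and> n \<le> x \<and> x < n + r then arrs s ''B'' [Suc i, x - n, b] else arrs s ''W'' [x, y]))"
proof -
  let ?I = "\<lambda>k ar. \<forall>x y. ar ''W'' [x, y] =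
    (if x = i \<and> n \<le> y \<and> y < n + k then arrs s ''B'' [Suc i, a, y - n] / arrs s ''B'' [Suc i, a, b]
     else if y = i \<and> n \<le> x \<and> x < n + k then arrs s ''B'' [Suc i, x - n, b] else arrs s ''W'' [x, y])"
  show ?thesis
    unfolding store_factors_def
  proof (rule runs_For[where I = ?I], goal_cases)
    case (5 k s')
    have v: "nvars s' ''n'' = n" "nvars s' ''i'' = i" "nvars s' ''a'' = a" "nvars s' ''b'' = b"
        "nvars s' ''k'' = k" "arrs s' ''B'' = arrs s ''B''"
      using unchangedD[OF 5(2)] s 5(3) by auto
    let ?R = "\<lambda>s1. arrs s1 ''W'' = (arrs s' ''W'')
      ([i, n + k] := arrs s ''B'' [Suc i, a, k] / arrs s ''B'' [Suc i, a, b])"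
    show ?case
    proof (rule runs_Seq[where R = ?R], goal_cases)
      case 1
      then show ?case by (rule runs_FSet) (use v bounds 5(1) D in \<open>auto simp: eval_simps\<close>)
    next
      case (2 s1)
      have v1: "nvars s1 ''n'' = n" "nvars s1 ''i'' = i" "nvars s1 ''a'' = a" "nvars s1 ''b'' = b"
          "nvars s1 ''k'' = k" "arrs s1 ''B'' = arrs s ''B''"
        using unchangedD[OF 2(1)] v by auto
      have upd: "((arrs s1 ''W'')([n + k, i] := arrs s ''B'' [Suc i, k, b])) [x, y] =
          (if x = i \<and> n \<le> y \<and> y < n + Suc k then arrs s ''B'' [Suc i, a, y - n] / arrs s ''B'' [Suc i, a, b]
           else if y = i \<and> n \<le> x \<and> x < n + Suc k then arrs s ''B'' [Suc i, x - n, b] else arrs s ''W'' [x, y])" for x y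
        using 5(4) 2(2) bounds by (auto simp: less_Suc_eq)
      show ?case
        by (rule runs_FSet) (use v1 bounds 5(1) D upd in \<open>auto simp: eval_simps\<close>)
    qed
  qed (use s D in \<open>auto simp: eval_simps unchanged_def\<close>)
qed

text \<open>The closing implication is shaped for the search loops: a nonzero entry establishes the
  factors for \<open>i\<close>, and a factorisation found earlier persists.\<close>

lemma runs_factor_at:
  fixes s :: "'a::field state"
  assumes s: "nvars s ''n'' = n" "nvars s ''r'' = r" "nvars s ''i'' = i" "nvars s ''a'' = a" "nvars s ''b'' = b"
    and bounds: "i < n" "a < r" "b < r" and D: "D = ops_bound n r"
    and rank1: "\<And>k l. k < r \<Longrightarrow> l < r \<Longrightarrow>
      arrs s ''B'' [Suc i, k, l] * arrs s ''B'' [Suc i, a, b] = arrs s ''B'' [Suc i, k, b] * arrs s ''B'' [Suc i, a, l]"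
    and pre: "bordered_shape n r (arrs s ''W'')" "\<And>q. q < i \<Longrightarrow> factored n r (arrs s ''B'') (arrs s ''W'') q"
  shows "runs h factor_at (D + loop_cost D (D + D)) s (\<lambda>s'. bordered_shape n r (arrs s' ''W'') \<and>
    (\<forall>q<i. factored n r (arrs s ''B'') (arrs s' ''W'') q) \<and>
    (factored n r (arrs s ''B'') (arrs s ''W'') i \<or> arrs s ''B'' [Suc i, a, b] \<noteq> 0 \<longrightarrow>
      factored n r (arrs s ''B'') (arrs s' ''W'') i))"
  unfolding factor_at_def
proof (rule runs_Cond, goal_cases)
  case 1
  then have nz: "arrs s ''B'' [Suc i, a, b] \<noteq> 0" using s by (simp add: eval_simps)
  show ?case
  proof (rule runs_weaken[OF runs_store_factors[OF s bounds D] order_refl], goal_cases)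
    case (1 s')
    then have W: "arrs s' ''W'' [x, y] =
        (if x = i \<and> n \<le> y \<and> y < n + r then arrs s ''B'' [Suc i, a, y - n] / arrs s ''B'' [Suc i, a, b]
         else if y = i \<and> n \<le> x \<and> x < n + r then arrs s ''B'' [Suc i, x - n, b] else arrs s ''W'' [x, y])" for x y
      by blast
    have "bordered_shape n r (arrs s' ''W'')"
      using pre(1) bounds by (auto simp: bordered_shape_def W)
    moreover have "factored n r (arrs s ''B'') (arrs s' ''W'') q" if "q < i" for q
      using pre(2)[OF that] that bounds by (auto simp: factored_def W)
    \<comment> \<open>The minor identity divided by the nonzero entry at \<open>a\<close>,
      \<open>b\<close>.\<close>
    moreover have "factored n r (arrs s ''B'') (arrs s' ''W'') i"
      using rank1 nz bounds by (auto simp: factored_def W field_simps)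
    ultimately show ?case by blast
  qed
next
  case 2
  then have "arrs s ''B'' [Suc i, a, b] = 0" using s by (simp add: eval_simps)
  then show ?case by (intro runs_Skip) (use pre in \<open>auto simp: loop_cost_def\<close>)
next
  case 3
  then show ?case using s bounds D by (simp add: eval_simps)
qed

lemma runs_load_factors:
  fixes s :: "'a::field state"
  assumes s: "nvars s ''n'' = n" "nvars s ''r'' = r" and D: "D = ops_bound n r"
    and B: "arrs s ''B'' = B"
    and nz: "\<And>i. i < n \<Longrightarrow> \<exists>a<r. \<exists>b<r. B [Suc i, a, b] \<noteq> 0"
    and rank1: "\<And>i a b k l. i < n \<Longrightarrow> a < r \<Longrightarrow> b < r \<Longrightarrow> k < r \<Longrightarrow> l < r \<Longrightarrow>
      B [Suc i, k, l] * B [Suc i, a, b] = B [Suc i, k, b] * B [Suc i, a, l]"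
    and W: "\<And>x y. arrs s ''W'' [x, y] = 0"
  shows "runs h load_factors (loop_cost D (loop_cost D (loop_cost D (D + loop_cost D (D + D))))) s
    (\<lambda>s'. bordered_shape n r (arrs s' ''W'') \<and> (\<forall>q<n. factored n r B (arrs s' ''W'') q))"
proof -
  \<comment> \<open>\<open>?I\<close>, \<open>?J\<close> and \<open>?H\<close> belong to the loops
    over \<open>i\<close>, \<open>a\<close> and \<open>b\<close>: the factors for \<open>i\<close>
    are right as soon as a nonzero entry has been visited.\<close>
  let ?I = "\<lambda>i ar. bordered_shape n r (ar ''W'') \<and> (\<forall>q<i. factored n r B (ar ''W'') q)"
  let ?J = "\<lambda>i a ar. ?I i ar \<and> ((\<exists>a'<a. \<exists>b<r. B [Suc i, a', b] \<noteq> 0) \<longrightarrow> factored n r B (ar ''W'') i)"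
  let ?H = "\<lambda>i a b ar. ?J i a ar \<and> ((\<exists>b'<b. B [Suc i, a, b'] \<noteq> 0) \<longrightarrow> factored n r B (ar ''W'') i)"
  show ?thesis
    unfolding load_factors_def
  proof (rule runs_For[where I = ?I], goal_cases)
    case (5 i s1)
    note mods = factor_at_def store_factors_def
    have v1: "nvars s1 ''n'' = n" "nvars s1 ''r'' = r" "nvars s1 ''i'' = i" "arrs s1 ''B'' = B"
      using unchangedD[OF 5(2)] s B 5(3) by (auto simp: mods)
    have "runs h (For ''a'' (NVar ''r'') (For ''b'' (NVar ''r'') factor_at))
        (loop_cost D (loop_cost D (D + loop_cost D (D + D)))) s1 (\<lambda>s'. ?J i r (arrs s'))"
    proof (rule runs_For[where I = "?J i"], goal_cases)
      case a: (5 a s2)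
      have v2: "nvars s2 ''n'' = n" "nvars s2 ''r'' = r" "nvars s2 ''i'' = i" "nvars s2 ''a'' = a"
          "arrs s2 ''B'' = B"
        using unchangedD[OF a(2)] v1 a(3) by (auto simp: mods)
      have "runs h (For ''b'' (NVar ''r'') factor_at)
          (loop_cost D (D + loop_cost D (D + D))) s2 (\<lambda>s'. ?H i a r (arrs s'))"
      proof (rule runs_For[where I = "?H i a"], goal_cases)
        case b: (5 b s3)
        have v3: "nvars s3 ''n'' = n" "nvars s3 ''r'' = r" "nvars s3 ''i'' = i" "nvars s3 ''a'' = a"
            "nvars s3 ''b'' = b" and B3: "arrs s3 ''B'' = B"
          using unchangedD[OF b(2)] v2 b(3) by (auto simp: mods)
        show ?case
        proof (rule runs_weaken[OF runs_factor_at[OF v3 5(1) a(1) b(1) D] order_refl], goal_cases)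
          case (1 k l)
          then show ?case using rank1 5(1) a(1) b(1) by (simp add: B3)
        next
          case 2
          then show ?case using b(4) by blast
        next
          case (3 q)
          then show ?case using b(4) by (simp add: B3)
        next
          case (4 s')
          then show ?case using b(4) by (auto simp: B3 less_Suc_eq)
        qed
      qed (use v2 a(4) D in \<open>auto simp: eval_simps unchanged_def mods\<close>)
      then show ?case
        by (rule runs_weaken[OF _ order_refl]) (auto simp: less_Suc_eq)
    qed (use v1 5(4) D in \<open>auto simp: eval_simps unchanged_def mods\<close>)
    then show ?case
      by (rule runs_weaken[OF _ order_refl]) (use nz[OF 5(1)] in \<open>auto simp: less_Suc_eq\<close>)
  qed (use s W D in \<open>auto simp: eval_simps unchanged_def factor_at_def store_factors_def bordered_shape_def\<close>)
qed

lemma runs_load_constant: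
  fixes s :: "'a::field state"
  assumes s: "nvars s ''n'' = n" "nvars s ''r'' = r" and D: "D = ops_bound n r"
  shows "runs h load_constant (loop_cost D (loop_cost D D)) s (\<lambda>s'. \<forall>x y. arrs s' ''W'' [x, y] =
    (if n \<le> x \<and> x < n + r \<and> n \<le> y \<and> y < n + r then arrs s ''B'' [0, x - n, y - n] else arrs s ''W'' [x, y]))"
proof -
  let ?I = "\<lambda>i ar. \<forall>x y. ar ''W'' [x, y] =
    (if n \<le> x \<and> x < n + i \<and> n \<le> y \<and> y < n + r then arrs s ''B'' [0, x - n, y - n] else arrs s ''W'' [x, y])"
  let ?J = "\<lambda>i k ar. \<forall>x y. ar ''W'' [x, y] =
    (if n \<le> x \<and> x < n + i \<and> n \<le> y \<and> y < n + r \<or> x = n + i \<and> n \<le> y \<and> y < n + k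
     then arrs s ''B'' [0, x - n, y - n] else arrs s ''W'' [x, y])"
  show ?thesis
    unfolding load_constant_def
  proof (rule runs_For[where I = ?I], goal_cases)
    case (5 i s1)
    have v1: "nvars s1 ''n'' = n" "nvars s1 ''r'' = r" "nvars s1 ''i'' = i" "arrs s1 ''B'' = arrs s ''B''"
      using unchangedD[OF 5(2)] s 5(3) by auto
    show ?case
    proof (rule runs_weaken[OF runs_For[where I = "?J i" and m = r] order_refl], goal_cases)
      case k: (5 k s2)
      have v2: "nvars s2 ''n'' = n" "nvars s2 ''i'' = i" "nvars s2 ''k'' = k" "arrs s2 ''B'' = arrs s ''B''"
        using unchangedD[OF k(2)] v1 k(3) by auto
      show ?case
        by (rule runs_FSet) (use v2 k(1,4) 5(1) D in \<open>auto simp: eval_simps less_Suc_eq\<close>)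
    next
      case (6 s')
      then show ?case by (auto simp: less_Suc_eq)
    qed (use v1 5(4) D in \<open>auto simp: eval_simps unchanged_def\<close>)
  qed (use s D in \<open>auto simp: eval_simps unchanged_def\<close>)
qed

lemma runs_load_identity:
  fixes s :: "'a::field state"
  assumes s: "nvars s ''n'' = n" "nvars s ''r'' = r" and D: "D = ops_bound n r"
  shows "runs h load_identity (loop_cost D D) s (\<lambda>s'. \<forall>x y. arrs s' ''W'' [x, y] =
    (if x < n + r \<and> y = n + r + x then 1 else arrs s ''W'' [x, y]))"
proof -
  let ?I = "\<lambda>i ar. \<forall>x y. ar ''W'' [x, y] =
    (if x < i \<and> y = n + r + x then 1 else arrs s ''W'' [x, y])"
  show ?thesis
    unfolding load_identity_def
  proof (rule runs_For[where I = ?I], goal_cases)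
    case (5 i s1)
    have v: "nvars s1 ''n'' = n" "nvars s1 ''r'' = r" "nvars s1 ''i'' = i"
      using unchangedD[OF 5(2)] s 5(3) by auto
    show ?case
      by (rule runs_FSet) (use v 5 D in \<open>auto simp: eval_simps less_Suc_eq\<close>)
  qed (use s D in \<open>auto simp: eval_simps unchanged_def\<close>)
qed

lemma runs_write_output:
  fixes s :: "'a::field state"
  assumes s: "nvars s ''n'' = n" "nvars s ''r'' = r" and D: "D = ops_bound n r"
  shows "runs h write_output (loop_cost D (loop_cost D D)) s (\<lambda>s'. \<forall>x<n. \<forall>y<n. arrs s' ''A'' [x, y] =
    - (arrs s ''W'' [x, n + r + y] / arrs s ''W'' [x, x]))"
proof -
  let ?v = "\<lambda>x y. - (arrs s ''W'' [x, n + r + y] / arrs s ''W'' [x, x])"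
  let ?I = "\<lambda>i ar. \<forall>x<i. \<forall>y<n. ar ''A'' [x, y] = ?v x y"
  let ?J = "\<lambda>i j ar. ?I i ar \<and> (\<forall>y<j. ar ''A'' [i, y] = ?v i y)"
  show ?thesis
    unfolding write_output_def
  proof (rule runs_For[where I = ?I], goal_cases)
    case (5 i s1)
    have v1: "nvars s1 ''n'' = n" "nvars s1 ''r'' = r" "nvars s1 ''i'' = i" "arrs s1 ''W'' = arrs s ''W''"
      using unchangedD[OF 5(2)] s 5(3) by auto
    show ?case
    proof (rule runs_weaken[OF runs_For[where I = "?J i" and m = n] order_refl], goal_cases)
      case j: (5 j s2)
      have v2: "nvars s2 ''n'' = n" "nvars s2 ''r'' = r" "nvars s2 ''i'' = i" "nvars s2 ''j'' = j"
          "arrs s2 ''W'' = arrs s ''W''"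
        using unchangedD[OF j(2)] v1 j(3) by auto
      show ?case
        by (rule runs_FSet) (use v2 j(1,4) 5(1) D in \<open>auto simp: eval_simps less_Suc_eq\<close>)
    next
      case (6 s')
      then show ?case by (auto simp: less_Suc_eq)
    qed (use v1 5(4) D in \<open>auto simp: eval_simps unchanged_def\<close>)
  qed (use s D in \<open>auto simp: eval_simps unchanged_def\<close>)
qed

lemma det_nonzero_trivial_kernel:
  fixes K :: "nat \<Rightarrow> nat \<Rightarrow> 'a::field"
  assumes det: "det (mat N N (\<lambda>(i, j). K i j)) \<noteq> 0"
    and x: "\<And>i. i < N \<Longrightarrow> (\<Sum>j<N. K i j * x j) = 0" and j: "j < N"
  shows "x j = 0"
proof -
  have "mat N N (\<lambda>(i, j). K i j) *\<^sub>v vec N x = 0\<^sub>v N"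
    by (rule eq_vecI) (auto simp: scalar_prod_def atLeast0LessThan x)
  then have "vec N x = 0\<^sub>v N"
    using det det_0_iff_vec_prod_zero_field[of "mat N N (\<lambda>(i, j). K i j)" N]
    by (metis mat_carrier vec_carrier)
  then show ?thesis using j by (metis index_vec index_zero_vec(1))
qed

section \<open>Polynomial bounds on the running time\<close>

definition polynomial_fun :: "(nat \<Rightarrow> nat) \<Rightarrow> bool" where
  "polynomial_fun f \<longleftrightarrow> (\<exists>q. \<forall>m. poly q m = f m)"

lemma polynomial_fun_const: "polynomial_fun (\<lambda>_. c)"
  unfolding polynomial_fun_def by (rule exI[of _ "[:c:]"]) simp

lemma polynomial_fun_id: "polynomial_fun (\<lambda>m. m)"
  unfolding polynomial_fun_def by (rule exI[of _ "[:0, 1:]"]) simp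

lemma polynomial_fun_add: "polynomial_fun f \<Longrightarrow> polynomial_fun g \<Longrightarrow> polynomial_fun (\<lambda>m. f m + g m)"
  unfolding polynomial_fun_def by (metis poly_add)

lemma polynomial_fun_mult: "polynomial_fun f \<Longrightarrow> polynomial_fun g \<Longrightarrow> polynomial_fun (\<lambda>m. f m * g m)"
  unfolding polynomial_fun_def by (metis poly_mult)

lemmas polynomial_fun_intros =
  polynomial_fun_const polynomial_fun_id polynomial_fun_add polynomial_fun_mult

lemma polynomial_fun_loop_cost:
  "polynomial_fun f \<Longrightarrow> polynomial_fun g \<Longrightarrow> polynomial_fun (\<lambda>m. loop_cost (f m) (g m))"
  unfolding loop_cost_def by (intro polynomial_fun_intros)

text \<open>The budgets of the five stages of \<open>diag_prog\<close>, nested as its loops are,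
  with \<open>D\<close> standing for \<open>ops_bound n r\<close>.\<close>

definition diag_prog_cost :: "nat \<Rightarrow> nat" where
  "diag_prog_cost D = loop_cost D (loop_cost D (loop_cost D (D + loop_cost D (D + D)))) +
     (loop_cost D (loop_cost D D) + (loop_cost D D +
       (loop_cost D (loop_cost D (D + (D + loop_cost D D)) + loop_cost D (D + (D + loop_cost D D))) +
          loop_cost D (loop_cost D D))))"

lemma polynomial_fun_diag_prog_cost: "polynomial_fun (\<lambda>m. diag_prog_cost (100 * (m + 1)))"
  unfolding diag_prog_cost_def by (intro polynomial_fun_intros polynomial_fun_loop_cost)

section \<open>Assembling the stages\<close>

lemma runs_diag_prog:
  fixes A :: "'a::field mat" and B :: "nat \<Rightarrow> 'a mat"
  assumes A: "A \<in> carrier_mat n n" and B: "\<And>i. i \<le> n \<Longrightarrow> B i \<in> carrier_mat r r"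
    and rank: "\<And>i. i < n \<Longrightarrow> vec_space.rank r (B (Suc i)) = 1"
    and eq: "det_plus_Y n A = det (pencil n r B)"
  shows "runs h diag_prog (diag_prog_cost (ops_bound n r)) (input_state n r B)
    (\<lambda>s. det_plus_Y n A = det_plus_Y n (output_mat n s))"
proof -
  define s where "s = input_state n r B"
  define D where "D = ops_bound n r"
  have s: "nvars s ''n'' = n" "nvars s ''r'' = r" and W: "arrs s ''W'' [x, y] = 0" for x y
    by (simp_all add: s_def input_state_def)
  have Bs: "arrs s ''B'' [k, a, b] = B k $$ (a, b)" if "k \<le> n" "a < r" "b < r" for k a b
    using that by (simp add: s_def input_state_def)
  have nz: "\<exists>a<r. \<exists>b<r. arrs s ''B'' [Suc i, a, b] \<noteq> 0" if "i < n" for i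
  proof -
    obtain a b where "a < r" "b < r" "B (Suc i) $$ (a, b) \<noteq> 0"
      using rank_1_nonzero_entry[OF B rank] \<open>i < n\<close> by (metis Suc_leI)
    then show ?thesis using Bs[of "Suc i" a b] \<open>i < n\<close> by (intro exI[of _ a] exI[of _ b] conjI) auto
  qed
  have minors: "arrs s ''B'' [Suc i, k, l] * arrs s ''B'' [Suc i, a, b] =
      arrs s ''B'' [Suc i, k, b] * arrs s ''B'' [Suc i, a, l]"
    if "i < n" "a < r" "b < r" "k < r" "l < r" for i a b k l
    using rank_1_minors[OF B rank] that by (simp add: Bs)
  note mods = load_factors_def factor_at_def store_factors_def load_constant_def load_identity_def
    eliminate_def make_pivot_def clear_column_def add_row_def
  have load: "runs h load_factors (loop_cost D (loop_cost D (loop_cost D (D + loop_cost D (D + D))))) s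
    (\<lambda>s'. bordered_shape n r (arrs s' ''W'') \<and> (\<forall>q<n. factored n r (arrs s ''B'') (arrs s' ''W'') q))"
    by (rule runs_load_factors[OF s D_def refl]) (use nz minors W in auto)
  show ?thesis
    unfolding diag_prog_def diag_prog_cost_def s_def[symmetric] D_def[symmetric]
  proof (rule runs_Seq[OF load], goal_cases)
    case (1 s1)
    have s1: "nvars s1 ''n'' = n" "nvars s1 ''r'' = r" and B1: "arrs s1 ''B'' = arrs s ''B''"
      using unchangedD[OF 1(1)] s by (auto simp: mods)
    show ?case
    proof (rule runs_Seq[OF runs_load_constant[OF s1 D_def]], goal_cases)
      case c: (1 s2)
      have s2: "nvars s2 ''n'' = n" "nvars s2 ''r'' = r"
        using unchangedD[OF c(1)] s1 by (auto simp: mods)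
      show ?case
      proof (rule runs_Seq[OF runs_load_identity[OF s2 D_def]], goal_cases)
        case i: (1 s3)
        have s3: "nvars s3 ''n'' = n" "nvars s3 ''r'' = r"
          using unchangedD[OF i(1)] s2 by (auto simp: mods)
        \<comment> \<open>\<open>K\<close> is the whole working array after loading; the locale
          constrains only its first \<open>n + r\<close> rows and columns.\<close>
        define K where "K i j = arrs s3 ''W'' [i, j]" for i j
        have W3: "K x y = (if x < n + r \<and> y = n + r + x then 1
            else if n \<le> x \<and> x < n + r \<and> n \<le> y \<and> y < n + r then arrs s ''B'' [0, x - n, y - n]
            else arrs s1 ''W'' [x, y])" for x y
          using i(2) c(2) by (simp add: K_def B1)
        have shape: "bordered_shape n r (arrs s1 ''W'')"
          and fact: "\<And>q. q < n \<Longrightarrow> factored n r (arrs s ''B'') (arrs s1 ''W'') q"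
          using 1(2) by auto
        interpret bordered_pencil n r A B K
        proof
          show "K i j = 0" if "i < n" "j < n" for i j
            using that shape by (auto simp: W3 bordered_shape_def)
          show "K (n + a) (n + b) = B 0 $$ (a, b)" if "a < r" "b < r" for a b
            using that by (simp add: W3 Bs)
          show "B (Suc i) $$ (a, b) = K (n + a) i * K i (n + b)" if "i < n" "a < r" "b < r" for i a b
            using fact[OF that(1)] that Bs[of "Suc i" a b] by (auto simp: W3 factored_def)
        qed (use A B eq in auto)
        \<comment> \<open>The right half starts as the identity, so the relation between the halves
          in \<open>reduced\<close> holds with \<open>M = K\<close>.\<close>
        have right: "K i (n + r + k) = (if i = k then 1 else 0)" if "i < n + r" "k < n + r" for i k
          using that shape by (auto simp: W3 bordered_shape_def)
        have "K i j = (\<Sum>k<n + r. K i (n + r + k) * K k j)" if "i < n + r" "j < n + r" for i j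
        proof -
          have "(\<Sum>k<n + r. K i (n + r + k) * K k j) = (\<Sum>k<n + r. if k = i then K k j else 0)"
            using that by (intro sum.cong) (auto simp: right)
          then show ?thesis using that by simp
        qed
        moreover have "x j = 0"
          if "\<forall>i<n + r. (\<Sum>j<n + r. K i j * x j) = 0" "j < n + r" for x j
          by (rule det_nonzero_trivial_kernel[of "n + r" K]) (use that det_bordered_pencil in auto)
        ultimately have "reduced (n + r) K 0 K"
          unfolding reduced_def by blast
        then have red: "reduced (n + r) K 0 (\<lambda>i j. arrs s3 ''W'' [i, j])"
          by (simp add: K_def[abs_def])
        show ?case
        proof (rule runs_Seq[OF runs_eliminate[OF s3 D_def red]], goal_cases)
          case e: (1 s4)
          have s4: "nvars s4 ''n'' = n" "nvars s4 ''r'' = r"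
            using unchangedD[OF e(1)] s3 by (auto simp: mods)
          show ?case
          proof (rule runs_weaken[OF runs_write_output[OF s4 D_def] order_refl], goal_cases)
            case (1 s5)
            let ?L = "\<lambda>i k. arrs s4 ''W'' [i, n + r + k] / arrs s4 ''W'' [i, i]"
            have "output_mat n s5 = mat n n (\<lambda>(i, j). - ?L i j)"
              using 1(2) by (intro eq_matI) (auto simp: output_mat_def)
            then show ?case
              using det_plus_Y_inverse[of ?L] reduced_inverse[OF e(2)] by simp
          qed
        qed
      qed
    qed
  qed
qed

theorem theorem3p7:
  shows "\<exists>(P :: com) (q :: nat poly).
    \<forall>(n :: nat) (r :: nat) (A :: 'a::field mat) (B :: nat \<Rightarrow> 'a mat) (h :: 'a mpoly).
      A \<in> carrier_mat n n \<longrightarrow>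
      h = det_plus_Y n A \<longrightarrow>
      (\<forall>i\<in>{0..n}. B i \<in> carrier_mat r r) \<longrightarrow>
      (\<forall>i\<in>{1..n}. vec_space.rank r (B i) = 1) \<longrightarrow>
      det_plus_Y n A = det (pencil n r B) \<longrightarrow>
      (\<exists>t s. exec (meval h) P (input_state n r B) t s \<and>
             t \<le> poly q (n + r) \<and>
             output_mat n s \<in> carrier_mat n n \<and>
             h = det_plus_Y n (output_mat n s))"
proof -
  \<comment> \<open>The sum \<open>n + r\<close> is the single size parameter:
    \<open>ops_bound n r\<close> is \<open>100 * (m + 1)\<close> at
    \<open>m = n + r\<close>.\<close>
  obtain q where q: "\<And>m. poly q m = diag_prog_cost (100 * (m + 1))"
    using polynomial_fun_diag_prog_cost unfolding polynomial_fun_def by blast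
  show ?thesis
  proof (intro exI[of _ diag_prog] exI[of _ q] allI impI)
    fix n r :: nat and A :: "'a mat" and B :: "nat \<Rightarrow> 'a mat" and h :: "'a mpoly"
    assume A: "A \<in> carrier_mat n n" and h: "h = det_plus_Y n A"
      and B: "\<forall>i\<in>{0..n}. B i \<in> carrier_mat r r"
      and rank: "\<forall>i\<in>{1..n}. vec_space.rank r (B i) = 1"
      and eq: "det_plus_Y n A = det (pencil n r B)"
    have "runs (meval h) diag_prog (diag_prog_cost (ops_bound n r)) (input_state n r B)
        (\<lambda>s. det_plus_Y n A = det_plus_Y n (output_mat n s))"
      by (rule runs_diag_prog) (use A B rank eq in auto)
    then show "\<exists>t s. exec (meval h) diag_prog (input_state n r B) t s \<and> t \<le> poly q (n + r) \<and>
        output_mat n s \<in> carrier_mat n n \<and> h = det_plus_Y n (output_mat n s)"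
      unfolding runs_def q h output_mat_def by auto
  qed
qed

end
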